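(* Let $q$ be a prime power and $n$ a positive integer. Let $f,T\in\mathbb{F}_q[x]$ be monic divisors of $x^n-1$ with $\deg f=k$ and $\gcd\left(\frac{x^n-1}{f},T\right)\neq 1$, and let $m$ be a positive divisor of $q^n-1$. If $q^{n/2-k}\geq W(m)W(T)$, then $N_f(T,m)>0$.
   Context: For $h(x)=\sum_i a_ix^i\in\mathbb{F}_q[x]$, its linearized $q$-associate is $L_h(x)=\sum_i a_i x^{q^i}$, and $L_h(\alpha)=\sum_i a_i\alpha^{q^i}$ for $\alpha\in\mathbb{F}_{q^n}$. For a positive integer $t$, $W(t)$ is the number of square-free positive divisors of $t$; for a monic polynomial $T$, $W(T)$ is the number of square-free monic divisors of $T$ in $\mathbb{F}_q[x]$. For $m\mid q^n-1$, an element $\alpha\in\mathbb{F}_{q^n}^*$ is $m$-free if whenever $\alpha=\beta^d$ for some $\beta\in\mathbb{F}_{q^n}$ and some positive divisor $d$ of $m$, we have $d=1$ (the element $0$ is not $m$-free). For a monic divisor $M$ of $x^n-1$ in $\mathbb{F}_q[x]$, an element $\alpha\in\mathbb{F}_{q^n}$ is $M$-free if whenever $\alpha=L_h(\beta)$ for some $\beta\in\mathbb{F}_{q^n}$ and some monic divisor $h$ of $M$, we have $h=1$. For monic divisors $f,T$ of $x^n-1$ and $m\mid q^n-1$, $N_f(T,m)$ denotes the number of $T$-free elements $\alpha\in\mathbb{F}_{q^n}$ such that $L_f(\alpha)$ is $m$-free. *)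

theory Defs
  imports "HOL-Computational_Algebra.Computational_Algebra"
begin

text \<open>Model: the ambient field type 'a plays the role of F_{q^n} (CARD('a) = q^n);
  F_q is its unique subfield of order q, namely the set of roots of x^q - x.
  Polynomials in F_q[x] are the 'a polys with all coefficients in that subfield.\<close>

definition Fq :: "nat \<Rightarrow> 'a::field set" where
  "Fq q = {x. x ^ q = x}"

definition Fq_poly :: "nat \<Rightarrow> 'a::field poly \<Rightarrow> bool" where
  "Fq_poly q h \<longleftrightarrow> (\<forall>i. coeff h i \<in> Fq q)"

definition Fq_dvd :: "nat \<Rightarrow> 'a::field poly \<Rightarrow> 'a poly \<Rightarrow> bool" where
  "Fq_dvd q h M \<longleftrightarrow> Fq_poly q h \<and> Fq_poly q M \<and> (\<exists>g. Fq_poly q g \<and> M = h * g)"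

definition monic_Fq_divisors :: "nat \<Rightarrow> 'a::field poly \<Rightarrow> 'a poly set" where
  "monic_Fq_divisors q M = {h. lead_coeff h = 1 \<and> Fq_dvd q h M}"

definition Fq_squarefree :: "nat \<Rightarrow> 'a::field poly \<Rightarrow> bool" where
  "Fq_squarefree q h \<longleftrightarrow> h \<noteq> 0 \<and> (\<forall>g. Fq_poly q g \<and> Fq_dvd q (g ^ 2) h \<longrightarrow> degree g = 0)"

definition Lq :: "nat \<Rightarrow> 'a::field poly \<Rightarrow> 'a \<Rightarrow> 'a" where
  "Lq q h \<alpha> = (\<Sum>i\<le>degree h. coeff h i * \<alpha> ^ (q ^ i))"

definition W_nat :: "nat \<Rightarrow> nat" where
  "W_nat t = card {d. d dvd t \<and> squarefree d}"

definition W_poly :: "nat \<Rightarrow> 'a::field poly \<Rightarrow> nat" where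
  "W_poly q T = card {h \<in> monic_Fq_divisors q T. Fq_squarefree q h}"

definition m_free :: "nat \<Rightarrow> 'a::field \<Rightarrow> bool" where
  "m_free m \<alpha> \<longleftrightarrow> \<alpha> \<noteq> 0 \<and>
     (\<forall>d \<beta>. d > 0 \<and> d dvd m \<and> \<alpha> = \<beta> ^ d \<longrightarrow> d = 1)"

definition M_free :: "nat \<Rightarrow> 'a::field poly \<Rightarrow> 'a \<Rightarrow> bool" where
  "M_free q M \<alpha> \<longleftrightarrow> (\<forall>h \<beta>. h \<in> monic_Fq_divisors q M \<and> \<alpha> = Lq q h \<beta> \<longrightarrow> h = 1)"

definition Fq_gcd_ne_1 :: "nat \<Rightarrow> 'a::field poly \<Rightarrow> 'a poly \<Rightarrow> bool" where
  "Fq_gcd_ne_1 q A B \<longleftrightarrow> (\<exists>h \<in> monic_Fq_divisors q A \<inter> monic_Fq_divisors q B. h \<noteq> 1)"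

definition N_f :: "nat \<Rightarrow> 'a::field poly \<Rightarrow> 'a poly \<Rightarrow> nat \<Rightarrow> nat" where
  "N_f q f T m = card {\<alpha>. M_free q T \<alpha> \<and> m_free m (Lq q f \<alpha>)}"

end

theory Submission
  imports Defs "HOL-Number_Theory.Residues" "HOL-Library.Cardinality"
begin

text \<open>Being \<open>T\<close>-free means avoiding the images of \<open>L_P\<close> for the irreducible factors \<open>P\<close> of \<open>T\<close>, and
  being \<open>m\<close>-free means avoiding the \<open>r\<close>-th powers for the prime factors \<open>r\<close> of \<open>m\<close>. Each of these two
  indicator functions is a positive multiple of \<open>1 + E\<close>, where \<open>E\<close> is a combination of nontrivial
  additive (multiplicative) characters whose coefficients have absolute sum less than \<open>W(T)\<close>
  (\<open>W(m)\<close>). Since \<open>L_f\<close> is additive with a kernel of at most \<open>q^k\<close> elements, Fourier inversion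
  reduces the mixed sums \<open>\<Sum> \<psi>(\<alpha>) \<chi>(L_f(\<alpha>))\<close> to at most \<open>q^k\<close> Gauss sums, so that they are bounded by
  \<open>q^(n/2 + k)\<close> without recourse to Weil's theorem; for trivial \<open>\<chi>\<close> the bound is \<open>q^k\<close>, which is
  what leaves room for equality in the hypothesis.\<close>

text \<open>The condition attached to one prime removes a subgroup of some index \<open>a\<close>.
  The indicator of its complement is \<open>(1 - 1/a) * (1 + E)\<close>, where \<open>E\<close>
  gives each of \<open>a - 1\<close> nontrivial characters the coefficient
  \<open>-1/(a - 1)\<close>. So one prime costs exactly 1, whatever \<open>a\<close> is, and
  multiplying w such factors leaves at most \<open>2 ^ w - 1\<close>. This is how W enters: w primes
  have \<open>2 ^ w\<close> square-free products. Let s and t be these powers of 2 for T and m, and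
  N = q^n. If no element qualified, then N - q^k \<le> (s - 1) q^k + (t - 1) s q^k sqrt N, while the
  hypothesis gives N \<ge> s t q^k sqrt N. Together they force sqrt N \<le> 1. The subfield is only
  a subset of the type, and a polynomial irreducible over it may split over the type. Division,
  Bezout and prime factors are therefore developed relative to \<open>Fq_poly\<close>.\<close>

hide_const (open) up_ring.coeff up_ring.monom module.smult

section \<open>Combinations of characters with controlled coefficients\<close>

text \<open>The number records the cost of one way of writing the function, not a minimal one.
  Building it term by term avoids index sets: equal characters arising in a product need not be
  merged.\<close>

inductive l1_comb :: "('a \<Rightarrow> complex) set \<Rightarrow> real \<Rightarrow> ('a \<Rightarrow> complex) \<Rightarrow> bool"
  for C where
  zero: "l1_comb C 0 (\<lambda>x. 0)"
| add: "l1_comb C s E \<Longrightarrow> \<chi> \<in> C \<Longrightarrow> l1_comb C (s + cmod w) (\<lambda>x. E x + w * \<chi> x)"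

lemma l1_comb_plus:
  assumes "l1_comb C s E" "l1_comb C t G"
  shows "l1_comb C (s + t) (\<lambda>x. E x + G x)"
  using assms(2)
proof induction
  case zero
  then show ?case using assms(1) by simp
next
  case (add t G \<chi> w)
  from l1_comb.add[OF add.IH add.hyps(2), of w] show ?case
    by (simp add: add.assoc)
qed

lemma l1_comb_scale:
  assumes "l1_comb C s E"
  shows "l1_comb C (cmod w * s) (\<lambda>x. w * E x)"
  using assms
proof induction
  case zero
  then show ?case using l1_comb.zero[of C] by simp
next
  case (add t G \<chi> v)
  from l1_comb.add[OF add.IH add.hyps(2), of "w * v"] show ?case
    by (simp add: algebra_simps norm_mult)
qed

lemma l1_comb_mono:
  assumes "l1_comb C s E" "C \<subseteq> D"
  shows "l1_comb D s E"
  using assms(1)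
  by induction (use assms(2) in \<open>auto intro: l1_comb.intros\<close>)

text \<open>The l1 norm of coefficients is submultiplicative. The target class \<open>K\<close> is
  left free so that the absence of trivial characters can be carried through products.\<close>

lemma l1_comb_times:
  assumes C: "l1_comb C s E" and D: "l1_comb D t G"
    and K: "\<And>\<chi> \<psi>. \<chi> \<in> C \<Longrightarrow> \<psi> \<in> D \<Longrightarrow> (\<lambda>x. \<chi> x * \<psi> x) \<in> K"
  shows "l1_comb K (s * t) (\<lambda>x. E x * G x)"
  using C
proof induction
  case zero
  then show ?case using l1_comb.zero[of K] by simp
next
  case (add s E \<chi> v)
  have "l1_comb K t (\<lambda>x. \<chi> x * G x)"
    using D
  proof induction
    case zero
    then show ?case using l1_comb.zero[of K] by simp
  next
    case (add t G \<psi> w)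
    from l1_comb.add[OF add.IH K[OF \<open>\<chi> \<in> C\<close> \<open>\<psi> \<in> D\<close>], of w] show ?case
      by (simp add: algebra_simps)
  qed
  from l1_comb_plus[OF add.IH l1_comb_scale[OF this, of v]] show ?case
    by (simp add: algebra_simps)
qed

lemma l1_comb_sum:
  assumes "finite I" "\<And>i. i \<in> I \<Longrightarrow> \<chi> i \<in> C"
  shows "l1_comb C (\<Sum>i\<in>I. cmod (w i)) (\<lambda>x. \<Sum>i\<in>I. w i * \<chi> i x)"
  using assms
proof (induction I)
  case empty
  then show ?case using l1_comb.zero[of C] by simp
next
  case (insert i I)
  hence "l1_comb C (\<Sum>i\<in>I. cmod (w i)) (\<lambda>x. \<Sum>i\<in>I. w i * \<chi> i x)" by simp
  from l1_comb.add[OF this, of "\<chi> i" "w i"] insert show ?case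
    by (simp add: add.commute)
qed

text \<open>The inner map \<open>h\<close> is the identity for additive characters and
  \<open>L\<close> for multiplicative ones; \<open>u\<close> collects the remaining factors of the
  summand.\<close>

lemma l1_comb_bound:
  assumes "l1_comb C s E"
    and M: "\<And>\<chi>. \<chi> \<in> C \<Longrightarrow> cmod (\<Sum>a\<in>A. \<chi> (h a) * u a) \<le> M"
  shows "cmod (\<Sum>a\<in>A. E (h a) * u a) \<le> s * M"
  using assms(1)
proof induction
  case zero
  then show ?case by simp
next
  case (add s E \<chi> w)
  have "(\<Sum>a\<in>A. (E (h a) + w * \<chi> (h a)) * u a)
      = (\<Sum>a\<in>A. E (h a) * u a) + w * (\<Sum>a\<in>A. \<chi> (h a) * u a)"
    by (simp add: algebra_simps sum.distrib sum_distrib_left)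
  also have "cmod \<dots> \<le> s * M + cmod w * M"
    using add.IH mult_left_mono[OF M[OF add.hyps(2)], of "cmod w"]
    by (intro order.trans[OF norm_triangle_ineq] add_mono) (auto simp: norm_mult)
  finally show ?case by (simp add: algebra_simps)
qed

text \<open>Multiplying the expansions of the single conditions never produces a trivial character
  besides the constant term, because the \<open>H j\<close> are independent in the sense of \<open>gen\<close>.\<close>
lemma sieve_expansion:
  fixes H :: "'i \<Rightarrow> 'a set"
  assumes "finite S"
    and mult: "\<And>\<chi> \<psi>. \<chi> \<in> Ch \<Longrightarrow> \<psi> \<in> Ch \<Longrightarrow> (\<lambda>x. \<chi> x * \<psi> x) \<in> Ch"
    and single: "\<And>j. j \<in> S \<Longrightarrow> \<exists>c>0. \<exists>E. (\<forall>x\<in>X. of_bool (x \<notin> H j) = of_real c * (1 + E x)) \<and>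
           l1_comb {\<chi> \<in> Ch. (\<forall>x\<in>X \<inter> H j. \<chi> x = 1) \<and> (\<exists>x\<in>X. \<chi> x \<noteq> 1)} 1 E"
    and gen: "\<And>j I \<chi>. j \<in> S \<Longrightarrow> I \<subseteq> S \<Longrightarrow> j \<notin> I \<Longrightarrow> \<chi> \<in> Ch \<Longrightarrow> \<forall>x\<in>X \<inter> H j. \<chi> x = 1
           \<Longrightarrow> \<forall>x\<in>X \<inter> (\<Inter>i\<in>I. H i). \<chi> x = 1 \<Longrightarrow> \<forall>x\<in>X. \<chi> x = 1"
  shows "\<exists>c>0. \<exists>E. (\<forall>x\<in>X. of_bool (\<forall>j\<in>S. x \<notin> H j) = of_real c * (1 + E x)) \<and>
           l1_comb {\<chi> \<in> Ch. (\<forall>x\<in>X \<inter> (\<Inter>i\<in>S. H i). \<chi> x = 1) \<and> (\<exists>x\<in>X. \<chi> x \<noteq> 1)} (2 ^ card S - 1) E"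
  using assms(1) single gen
proof (induction S)
  case empty
  show ?case
    by (intro exI[of _ "1::real"] conjI exI[of _ "\<lambda>x. 0"]) (auto intro: l1_comb.zero)
next
  case (insert j S)
  \<comment> \<open>Being 1 on the intersection is the invariant that makes \<open>gen\<close>
    applicable when the next condition is multiplied in.\<close>
  let ?K = "\<lambda>S. {\<chi> \<in> Ch. (\<forall>x\<in>X \<inter> (\<Inter>i\<in>S. H i). \<chi> x = 1) \<and> (\<exists>x\<in>X. \<chi> x \<noteq> 1)}"
  have "\<exists>c>0. \<exists>E. (\<forall>x\<in>X. of_bool (\<forall>j\<in>S. x \<notin> H j) = of_real c * (1 + E x)) \<and>
      l1_comb (?K S) (2 ^ card S - 1) E"
  proof (rule insert.IH)
    fix i I \<chi>
    assume "i \<in> S" "I \<subseteq> S" "i \<notin> I" "\<chi> \<in> Ch" "\<forall>x\<in>X \<inter> H i. \<chi> x = 1" "\<forall>x\<in>X \<inter> (\<Inter>i\<in>I. H i). \<chi> x = 1"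
    thus "\<forall>x\<in>X. \<chi> x = 1" by (intro insert.prems(2)[of i I]) auto
  qed (use insert.prems(1) in blast)
  then obtain c E where c: "c > 0" and E: "\<And>x. x \<in> X \<Longrightarrow> of_bool (\<forall>j\<in>S. x \<notin> H j) = of_real c * (1 + E x)"
    and combE: "l1_comb (?K S) (2 ^ card S - 1) E"
    by blast
  obtain d G where d: "d > 0" and G: "\<And>x. x \<in> X \<Longrightarrow> of_bool (x \<notin> H j) = of_real d * (1 + G x)"
    and combG: "l1_comb {\<chi> \<in> Ch. (\<forall>x\<in>X \<inter> H j. \<chi> x = 1) \<and> (\<exists>x\<in>X. \<chi> x \<noteq> 1)} 1 G"
    (is "l1_comb ?D 1 G")
    using insert.prems(1)[of j] by blast
  have EG: "l1_comb (?K (insert j S)) ((2 ^ card S - 1) * 1) (\<lambda>x. E x * G x)"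
  proof (rule l1_comb_times[OF combE combG])
    fix \<chi> \<psi> assume \<chi>: "\<chi> \<in> ?K S" and \<psi>: "\<psi> \<in> ?D"
    have "\<exists>x\<in>X. \<chi> x * \<psi> x \<noteq> 1"
    proof (rule ccontr)
      assume "\<not> ?thesis"
      hence *: "\<And>x. x \<in> X \<Longrightarrow> \<chi> x * \<psi> x = 1" by blast
      \<comment> \<open>If the product is trivial, \<open>\<psi>\<close> is the inverse of
        \<open>\<chi>\<close> and so inherits its triviality on the intersection, besides being
        trivial on \<open>H j\<close>.\<close>
      have "\<forall>x\<in>X \<inter> (\<Inter>i\<in>S. H i). \<psi> x = 1"
        using * \<chi> by fastforce
      hence "\<forall>x\<in>X. \<psi> x = 1"
        using insert.prems(2)[of j S \<psi>] \<psi> insert.hyps by blast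
      thus False using \<psi> by blast
    qed
    thus "(\<lambda>x. \<chi> x * \<psi> x) \<in> ?K (insert j S)"
      using \<chi> \<psi> mult by auto
  qed
  \<comment> \<open>\<open>(1 + E) * (1 + G)\<close> minus its constant term; with s =
    \<open>2 ^ card S\<close> the cost is (s - 1) + 1 + (s - 1) = 2 s - 1.\<close>
  have "l1_comb (?K (insert j S)) ((2 ^ card S - 1) + 1 + (2 ^ card S - 1) * 1)
      (\<lambda>x. E x + G x + E x * G x)"
    by (intro l1_comb_plus EG l1_comb_mono[OF combE] l1_comb_mono[OF combG]) auto
  moreover have "(2 ^ card S - 1) + 1 + (2 ^ card S - 1) * 1 = (2 ^ card (insert j S) - 1 :: real)"
    using insert.hyps by simp
  moreover have "of_bool (\<forall>i\<in>insert j S. x \<notin> H i) = of_real (c * d) * (1 + (E x + G x + E x * G x))"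
    if "x \<in> X" for x
  proof -
    have "of_bool (\<forall>i\<in>insert j S. x \<notin> H i) = of_bool (\<forall>j\<in>S. x \<notin> H j) * (of_bool (x \<notin> H j) :: complex)"
      by auto
    thus ?thesis using E[OF that] G[OF that] by (simp add: algebra_simps)
  qed
  ultimately show ?case using c d by (intro exI[of _ "c * d"] conjI exI) auto
qed

section \<open>Additive characters and Gauss sums\<close>

lemma sum_eq_0_if_translation:
  fixes f :: "'b \<Rightarrow> complex"
  assumes "bij_betw t A A" "\<And>x. x \<in> A \<Longrightarrow> f (t x) = c * f x" "c \<noteq> 1"
  shows "sum f A = 0"
proof -
  have "sum f A = (\<Sum>x\<in>A. f (t x))"
    using sum.reindex_bij_betw[OF assms(1), of f] by simp
  also have "\<dots> = c * sum f A"
    using assms(2) by (simp add: sum_distrib_left)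
  finally show ?thesis using assms(3) by (metis mult_cancel_right1)
qed

definition add_subgroup :: "'a::ab_group_add set \<Rightarrow> bool" where
  "add_subgroup H \<longleftrightarrow> 0 \<in> H \<and> (\<forall>x\<in>H. \<forall>y\<in>H. x - y \<in> H)"

lemma add_subgroup_plus:
  assumes "add_subgroup H" "x \<in> H" "y \<in> H"
  shows "x + y \<in> H"
proof -
  have "0 - y \<in> H" using assms unfolding add_subgroup_def by blast
  hence "x - (0 - y) \<in> H" using assms unfolding add_subgroup_def by blast
  thus ?thesis by simp
qed

lemma bij_betw_add_subgroup:
  assumes "add_subgroup H" "h \<in> H"
  shows "bij_betw (\<lambda>x. x + h) H H"
  by (rule bij_betw_byWitness[where f' = "\<lambda>x. x - h"])
     (use assms add_subgroup_plus[OF assms(1)] in \<open>auto simp: add_subgroup_def\<close>)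

text \<open>All nonempty fibres are translates of the kernel.\<close>

lemma card_kernel_image:
  fixes L :: "'a::{ab_group_add,finite} \<Rightarrow> 'b::ab_group_add"
  assumes "\<And>x y. L (x + y) = L x + L y"
  shows "card (range L) * card {x. L x = 0} = CARD('a)"
proof -
  interpret additive L by standard (rule assms)
  have fib: "card {x. L x = L a} = card {x. L x = 0}" for a
    by (rule bij_betw_same_card[of "\<lambda>x. x - a"],
        rule bij_betw_byWitness[where f' = "\<lambda>x. x + a"]) (auto simp: add diff)
  have "CARD('a) = (\<Sum>y\<in>range L. card {x. L x = y})"
    using sum.image_gen[of "UNIV :: 'a set" "\<lambda>_. 1::nat" L] by simp
  also have "\<dots> = (\<Sum>y\<in>range L. card {x. L x = 0})"
    by (rule sum.cong) (auto simp: fib)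
  finally show ?thesis by simp
qed

lemma add_subgroup_range:
  fixes L :: "'a::ab_group_add \<Rightarrow> 'b::ab_group_add"
  assumes "\<And>x y. L (x + y) = L x + L y"
  shows "add_subgroup (range L)"
proof -
  interpret additive L by standard (rule assms)
  show ?thesis unfolding add_subgroup_def
    by (metis (no_types, lifting) diff imageE rangeI zero)
qed

text \<open>The value at 0 is 0 for the trivial character too, so triviality has to be tested on
  \<open>- {0}\<close>.\<close>

definition mult_chars :: "('a::field \<Rightarrow> complex) set" where
  "mult_chars = {\<chi>. \<chi> 0 = 0 \<and> (\<forall>x y. \<chi> (x * y) = \<chi> x * \<chi> y) \<and> (\<forall>x. x \<noteq> 0 \<longrightarrow> cmod (\<chi> x) = 1)}"

locale additive_character =
  fixes \<psi> :: "'a::{field,finite} \<Rightarrow> complex"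
  assumes add: "\<psi> (x + y) = \<psi> x * \<psi> y"
    and norm [simp]: "cmod (\<psi> x) = 1"
    and nontrivial: "\<exists>x. \<psi> x \<noteq> 1"
begin

lemma nonzero [simp]: "\<psi> x \<noteq> 0"
  using norm[of x] by force

lemma zero [simp]: "\<psi> 0 = 1"
  using add[of 0 0] by simp

lemma minus: "\<psi> (- x) = cnj (\<psi> x)"
proof -
  have "\<psi> (- x) * \<psi> x = 1" using add[of "- x" x] by simp
  moreover have "cnj (\<psi> x) * \<psi> x = 1"
    using complex_norm_square[of "\<psi> x"] by (simp add: mult.commute)
  ultimately show ?thesis by (metis mult_cancel_right nonzero)
qed

lemma diff: "\<psi> (x - y) = \<psi> x * cnj (\<psi> y)"
  using add[of x "- y"] by (simp add: minus)

text \<open>The additive map \<open>g\<close> covers both twists \<open>h \<mapsto> b * h\<close>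
  and the combined argument \<open>b * a + c * L a\<close> of the mixed sums.\<close>

lemma sum_additive_subgroup:
  assumes H: "add_subgroup H" and g: "\<And>x y. g (x + y) = g x + g y"
  shows "(\<Sum>h\<in>H. \<psi> (g h)) = (if \<forall>h\<in>H. \<psi> (g h) = 1 then of_nat (card H) else 0)"
proof (cases "\<forall>h\<in>H. \<psi> (g h) = 1")
  case True
  then show ?thesis by simp
next
  case False
  then obtain h where h: "h \<in> H" "\<psi> (g h) \<noteq> 1" by blast
  show ?thesis
    unfolding if_not_P[OF False]
    by (rule sum_eq_0_if_translation[OF bij_betw_add_subgroup[OF H h(1)] _ h(2)])
       (simp add: g add)
qed

lemma sum_orthogonality: "(\<Sum>b\<in>UNIV. \<psi> (b * y)) = of_nat CARD('a) * of_bool (y = 0)"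
proof -
  have "add_subgroup (UNIV :: 'a set)" by (simp add: add_subgroup_def)
  note * = sum_additive_subgroup[OF this, of "\<lambda>b. b * y"]
  show ?thesis
  proof (cases "y = 0")
    case False
    obtain x where "\<psi> x \<noteq> 1" using nontrivial by blast
    hence "\<psi> ((x / y) * y) \<noteq> 1" using False by simp
    hence "\<not> (\<forall>b\<in>UNIV. \<psi> (b * y) = 1)" by blast
    thus ?thesis using * False by (simp add: algebra_simps)
  qed simp
qed

definition annihilator :: "'a set \<Rightarrow> 'a set" where
  "annihilator H = {b. \<forall>h\<in>H. \<psi> (b * h) = 1}"

text \<open>Poisson summation: membership is a sum of point masses at the elements of
  \<open>H\<close>; expanding each by orthogonality and summing over \<open>H\<close> first keeps
  only the frequencies in the annihilator.\<close>

lemma indicator_subgroup: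
  assumes H: "add_subgroup H"
  shows "of_nat CARD('a) * of_bool (x \<in> H) = of_nat (card H) * (\<Sum>b\<in>annihilator H. \<psi> (b * x))"
proof -
  have "of_nat CARD('a) * of_bool (x \<in> H) = (\<Sum>h\<in>H. of_nat CARD('a) * (of_bool (x - h = 0) :: complex))"
    by (simp add: sum_distrib_left[symmetric] sum.delta' of_bool_def del: sum_of_bool_eq)
  also have "\<dots> = (\<Sum>h\<in>H. \<Sum>b\<in>UNIV. \<psi> (b * (x - h)))"
    by (simp only: sum_orthogonality)
  also have "\<dots> = (\<Sum>b\<in>UNIV. \<psi> (b * x) * (\<Sum>h\<in>H. \<psi> (- b * h)))"
    by (subst sum.swap) (simp add: sum_distrib_left right_diff_distrib diff minus)
  also have "\<dots> = (\<Sum>b\<in>UNIV. if b \<in> annihilator H then of_nat (card H) * \<psi> (b * x) else 0)"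
  proof (intro sum.cong refl)
    fix b
    have "(\<forall>h\<in>H. \<psi> (- b * h) = 1) \<longleftrightarrow> b \<in> annihilator H"
      by (auto simp: annihilator_def minus)
    thus "\<psi> (b * x) * (\<Sum>h\<in>H. \<psi> (- b * h)) = (if b \<in> annihilator H then of_nat (card H) * \<psi> (b * x) else 0)"
      using sum_additive_subgroup[OF H, of "\<lambda>h. - b * h"] by (simp add: distrib_left)
  qed
  finally show ?thesis
    by (simp add: sum.If_cases sum_distrib_left)
qed

lemma card_annihilator:
  assumes H: "add_subgroup H"
  shows "card (annihilator H) * card H = CARD('a)"
proof -
  have "(of_nat CARD('a) :: complex) = of_nat (card (annihilator H) * card H)"
    using indicator_subgroup[OF H, of 0] H by (simp add: add_subgroup_def mult.commute)
  thus ?thesis by (metis of_nat_eq_iff)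
qed

text \<open>Multiplicative twists of the single character \<open>\<psi>\<close> suffice, since
  \<open>indicator_subgroup\<close> expands every additive subgroup in them.\<close>

definition chars :: "('a \<Rightarrow> complex) set" where
  "chars = range (\<lambda>b x. \<psi> (b * x))"

lemma chars_mult: "\<chi> \<in> chars \<Longrightarrow> \<chi>' \<in> chars \<Longrightarrow> (\<lambda>x. \<chi> x * \<chi>' x) \<in> chars"
proof -
  assume "\<chi> \<in> chars" "\<chi>' \<in> chars"
  then obtain b c where "\<chi> = (\<lambda>x. \<psi> (b * x))" "\<chi>' = (\<lambda>x. \<psi> (c * x))"
    unfolding chars_def by blast
  hence "(\<lambda>x. \<chi> x * \<chi>' x) = (\<lambda>x. \<psi> ((b + c) * x))"
    by (auto simp: algebra_simps add)
  thus ?thesis unfolding chars_def by blast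
qed

lemma complement_subgroup_expansion:
  assumes H: "add_subgroup H" and proper: "H \<noteq> UNIV"
  shows "\<exists>c>0. \<exists>E. (\<forall>x\<in>UNIV. of_bool (x \<notin> H) = of_real c * (1 + E x)) \<and>
           l1_comb {\<chi> \<in> chars. (\<forall>x\<in>UNIV \<inter> H. \<chi> x = 1) \<and> (\<exists>x\<in>UNIV. \<chi> x \<noteq> 1)} 1 E"
    (is "\<exists>c>0. \<exists>E. _ \<and> l1_comb ?K 1 E")
proof -
  \<comment> \<open>By \<open>card_annihilator\<close> the size of \<open>A\<close> is the index of
    \<open>H\<close>, hence at least 2 for a proper subgroup; otherwise \<open>w\<close> would
    divide by 0.\<close>
  define A where "A = annihilator H"
  have "card H < CARD('a)" using proper by (simp add: psubset_card_mono psubsetI)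
  hence A: "card A > 1"
    using card_annihilator[OF H] unfolding A_def
    by (metis less_irrefl_nat less_one linorder_neqE_nat mult_1 mult_zero_left not_less_zero)
  have A0: "0 \<in> A" by (simp add: A_def annihilator_def)
  have cardA: "card (A - {0}) = card A - 1" using A0 by simp
  define w :: complex where "w = - of_real (1 / (real (card A) - 1))"
  define E where "E = (\<lambda>x. \<Sum>b\<in>A - {0}. w * \<psi> (b * x))"
  have "l1_comb ?K (\<Sum>b\<in>A - {0}. cmod w) E"
    unfolding E_def
  proof (rule l1_comb_sum)
    fix b assume b: "b \<in> A - {0}"
    obtain x where "\<psi> x \<noteq> 1" using nontrivial by blast
    hence "\<psi> (b * (x / b)) \<noteq> 1" using b by simp
    hence "\<exists>x\<in>UNIV. \<psi> (b * x) \<noteq> 1" by blast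
    moreover have "(\<lambda>x. \<psi> (b * x)) \<in> chars" by (simp add: chars_def)
    ultimately show "(\<lambda>x. \<psi> (b * x)) \<in> ?K"
      using b by (simp add: A_def annihilator_def)
  qed simp
  moreover have "(\<Sum>b\<in>A - {0}. cmod w) = 1"
    using A unfolding w_def norm_minus_cancel norm_of_real
    by (simp add: cardA of_nat_diff)
  moreover have "of_bool (x \<notin> H) = of_real (1 - 1 / card A) * (1 + E x)" for x
  proof -
    have "of_nat (card A) * of_nat (card H) * of_bool (x \<in> H)
        = of_nat (card H) * (\<Sum>b\<in>A. \<psi> (b * x))"
      using indicator_subgroup[OF H, of x] card_annihilator[OF H] unfolding A_def
      by (metis of_nat_mult)
    moreover have "of_nat (card H) \<noteq> (0 :: complex)"
      using H by (auto simp: add_subgroup_def card_eq_0_iff)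
    ultimately have "of_nat (card A) * of_bool (x \<in> H) = (\<Sum>b\<in>A. \<psi> (b * x))"
      by (auto simp: algebra_simps)
    also have "\<dots> = 1 + (\<Sum>b\<in>A - {0}. \<psi> (b * x))"
      using A0 by (subst sum.remove[of A 0]) auto
    finally have *: "(\<Sum>b\<in>A - {0}. \<psi> (b * x)) = of_nat (card A) * of_bool (x \<in> H) - 1" by simp
    have "E x = w * (of_nat (card A) * of_bool (x \<in> H) - 1)"
      unfolding E_def sum_distrib_left[symmetric] * ..
    moreover have "of_nat (card A) \<noteq> (1::complex)" "of_nat (card A) \<noteq> (0::complex)"
      using A by (metis less_irrefl_nat of_nat_1_eq_iff) (use A in auto)
    ultimately show ?thesis
      by (cases "x \<in> H") (simp_all add: w_def field_simps)
  qed
  moreover have "1 - 1 / card A > (0::real)" using A by simp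
  ultimately show ?thesis by (metis (no_types, lifting))
qed

section \<open>Gauss sums and mixed character sums\<close>

definition gauss_sum :: "('a \<Rightarrow> complex) \<Rightarrow> 'a \<Rightarrow> complex" where
  "gauss_sum \<chi> b = (\<Sum>x\<in>UNIV. \<chi> x * \<psi> (b * x))"

text \<open>Here \<open>u\<close> is arbitrary, and \<open>gauss_sum u\<close> is its discrete
  Fourier transform.\<close>

lemma parseval:
  "(\<Sum>b\<in>UNIV. (cmod (gauss_sum u b))\<^sup>2) = CARD('a) * (\<Sum>x\<in>UNIV. (cmod (u x))\<^sup>2)"
proof -
  have "complex_of_real (\<Sum>b\<in>UNIV. (cmod (gauss_sum u b))\<^sup>2)
      = (\<Sum>b\<in>UNIV. \<Sum>x\<in>UNIV. \<Sum>y\<in>UNIV. u x * cnj (u y) * \<psi> (b * (x - y)))"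
    unfolding of_real_sum complex_norm_square gauss_sum_def
    by (simp add: sum_product right_diff_distrib diff algebra_simps)
  also have "\<dots> = (\<Sum>x\<in>UNIV. \<Sum>y\<in>UNIV. u x * cnj (u y) * (\<Sum>b\<in>UNIV. \<psi> (b * (x - y))))"
    unfolding sum_distrib_left by (subst sum.swap, rule sum.cong[OF refl], subst sum.swap) simp
  also have "\<dots> = (\<Sum>x\<in>UNIV. \<Sum>y\<in>UNIV. if x = y then of_nat CARD('a) * (u x * cnj (u x)) else 0)"
    unfolding sum_orthogonality by (intro sum.cong) auto
  also have "\<dots> = complex_of_real (CARD('a) * (\<Sum>x\<in>UNIV. (cmod (u x))\<^sup>2))"
    by (simp add: sum_distrib_left flip: complex_norm_square)
  finally show ?thesis by (simp only: of_real_eq_iff)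
qed

text \<open>At frequency 0 the sum vanishes, and substituting \<open>x * c\<close> shows that all
  other frequencies share one modulus. Parseval then gives (N - 1) times its square as N (N - 1),
  with N the size of the field.\<close>

lemma cmod_gauss_sum:
  assumes \<chi>: "\<chi> \<in> mult_chars" and "\<exists>x\<in>- {0}. \<chi> x \<noteq> 1"
  shows "cmod (gauss_sum \<chi> b) \<le> sqrt CARD('a)"
proof -
  have \<chi>0: "\<chi> 0 = 0" and \<chi>mult: "\<chi> (x * y) = \<chi> x * \<chi> y"
    and \<chi>norm: "x \<noteq> 0 \<Longrightarrow> cmod (\<chi> x) = 1" for x y
    using \<chi> unfolding mult_chars_def by auto
  have bij: "bij_betw (\<lambda>x. x * y) UNIV UNIV" if "y \<noteq> 0" for y :: 'a
    by (rule bij_betw_byWitness[where f' = "\<lambda>x. x / y"]) (use that in auto)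
  have zero: "gauss_sum \<chi> 0 = 0"
  proof -
    obtain y where y: "y \<noteq> 0" "\<chi> y \<noteq> 1" using assms(2) by auto
    have "sum \<chi> UNIV = 0"
      by (rule sum_eq_0_if_translation[OF bij[OF y(1)] _ y(2)]) (simp add: \<chi>mult)
    thus ?thesis by (simp add: gauss_sum_def)
  qed
  have same: "cmod (gauss_sum \<chi> c) = cmod (gauss_sum \<chi> 1)" if "c \<noteq> 0" for c
  proof -
    have "gauss_sum \<chi> 1 = (\<Sum>x\<in>UNIV. \<chi> (x * c) * \<psi> (1 * (x * c)))"
      unfolding gauss_sum_def
      using sum.reindex_bij_betw[OF bij[OF that], of "\<lambda>x. \<chi> x * \<psi> (1 * x)"] by simp
    also have "\<dots> = \<chi> c * gauss_sum \<chi> c"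
      unfolding gauss_sum_def by (simp add: \<chi>mult sum_distrib_left algebra_simps)
    finally show ?thesis using \<chi>norm[OF that] by (simp add: norm_mult)
  qed
  have card2: "CARD('a) > 1"
    using card_mono[of UNIV "{0, 1 :: 'a}"] by simp
  have "(CARD('a) - 1) * (cmod (gauss_sum \<chi> 1))\<^sup>2 = (\<Sum>b\<in>UNIV - {0 :: 'a}. (cmod (gauss_sum \<chi> 1))\<^sup>2)"
    by simp
  also have "\<dots> = (\<Sum>b\<in>UNIV - {0}. (cmod (gauss_sum \<chi> b))\<^sup>2)"
    by (rule sum.cong[OF refl]) (metis same DiffE singletonI)
  also have "\<dots> = (\<Sum>b\<in>UNIV. (cmod (gauss_sum \<chi> b))\<^sup>2)"
    by (rule sum.mono_neutral_left) (simp_all add: zero)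
  also have "\<dots> = CARD('a) * (\<Sum>x\<in>UNIV. (cmod (\<chi> x))\<^sup>2)"
    by (rule parseval)
  also have "(\<Sum>x\<in>UNIV. (cmod (\<chi> x))\<^sup>2) = (\<Sum>x\<in>UNIV - {0}. (cmod (\<chi> x))\<^sup>2)"
    by (rule sum.mono_neutral_right) (simp_all add: \<chi>0)
  also have "\<dots> = CARD('a) - 1"
    by (simp add: \<chi>norm)
  finally have "(cmod (gauss_sum \<chi> 1))\<^sup>2 = CARD('a)"
    using card2 by (metis gr_implies_not0 mult.commute mult_cancel_right of_nat_eq_0_iff zero_less_diff)
  hence "cmod (gauss_sum \<chi> 1) = sqrt CARD('a)"
    by (metis norm_ge_zero real_sqrt_unique)
  thus ?thesis using zero same[of b] by (cases "b = 0") auto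
qed

text \<open>Fourier inversion on the argument of \<open>\<chi>\<close> leaves Gauss sums, indexed by a coset of the
  annihilator of the image of \<open>L\<close>, which is as large as the kernel of \<open>L\<close>.\<close>
lemma mixed_sum_bound:
  fixes L :: "'a \<Rightarrow> 'a"
  assumes \<chi>: "\<chi> \<in> mult_chars" "\<exists>x\<in>- {0}. \<chi> x \<noteq> 1"
    and L: "\<And>x y. L (x + y) = L x + L y" and ker: "card {x. L x = 0} \<le> \<kappa>"
  shows "cmod (\<Sum>a\<in>UNIV. \<chi> (L a) * \<psi> (b * a)) \<le> \<kappa> * sqrt CARD('a)"
proof -
  \<comment> \<open>The frequencies that survive: those for which the twist by \<open>b\<close> and
    the character pulled back along \<open>L\<close> cancel.\<close>
  define C where "C = {c. \<forall>a. \<psi> (b * a + c * L a) = 1}"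
  have cardC: "card C \<le> \<kappa>"
  proof (cases "C = {}")
    case False
    then obtain c0 where c0: "c0 \<in> C" by blast
    have "c - c0 \<in> annihilator (range L)" if "c \<in> C" for c
    proof -
      have "\<psi> ((c - c0) * L a) = 1" for a
      proof -
        have "(c - c0) * L a = (b * a + c * L a) - (b * a + c0 * L a)"
          by (simp add: algebra_simps)
        thus ?thesis using that c0 by (simp only: diff) (simp add: C_def)
      qed
      thus ?thesis by (auto simp: annihilator_def)
    qed
    hence "card C \<le> card (annihilator (range L))"
      by (intro card_inj_on_le[of "\<lambda>c. c - c0"]) (auto simp: inj_on_def)
    also have "\<dots> = card {x. L x = 0}"
    proof -
      have "card (annihilator (range L)) * card (range L) = card {x. L x = 0} * card (range L)"
        using card_annihilator[OF add_subgroup_range[of L]] card_kernel_image[of L] L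
        by (simp add: mult.commute)
      thus ?thesis by (simp add: card_eq_0_iff)
    qed
    finally show ?thesis using ker by linarith
  qed simp
  \<comment> \<open>A new variable \<open>y\<close> takes the place of \<open>L a\<close>, with
    orthogonality enforcing equality. This detaches \<open>\<chi>\<close> from \<open>a\<close>, so
    the sum over \<open>a\<close> involves additive characters only.\<close>
  have "of_nat CARD('a) * (\<Sum>a\<in>UNIV. \<chi> (L a) * \<psi> (b * a))
      = (\<Sum>a\<in>UNIV. \<Sum>y\<in>UNIV. \<psi> (b * a) * \<chi> y * (of_nat CARD('a) * of_bool (L a - y = 0)))"
    by (simp add: sum_distrib_left algebra_simps of_bool_def if_distrib cong: if_cong)
  also have "\<dots> = (\<Sum>a\<in>UNIV. \<Sum>y\<in>UNIV. \<Sum>c\<in>UNIV. \<psi> (b * a) * \<chi> y * \<psi> (c * (L a - y)))"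
    unfolding sum_orthogonality[symmetric] by (simp add: sum_distrib_left)
  also have "\<dots> = (\<Sum>c\<in>UNIV. \<Sum>a\<in>UNIV. \<Sum>y\<in>UNIV. \<psi> (b * a) * \<chi> y * \<psi> (c * (L a - y)))"
    by (subst (2) sum.swap, subst sum.swap) simp
  also have "\<dots> = (\<Sum>c\<in>UNIV. (\<Sum>a\<in>UNIV. \<psi> (b * a + c * L a)) * gauss_sum \<chi> (- c))"
    unfolding gauss_sum_def sum_product
    by (intro sum.cong refl) (simp add: add diff minus right_diff_distrib)
  also have "\<dots> = (\<Sum>c\<in>UNIV. if c \<in> C then of_nat CARD('a) * gauss_sum \<chi> (- c) else 0)"
  proof (rule sum.cong)
    fix c
    have "(\<Sum>a\<in>UNIV. \<psi> (b * a + c * L a)) = (if c \<in> C then of_nat CARD('a) else 0)"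
      using sum_additive_subgroup[of UNIV "\<lambda>a. b * a + c * L a"]
      by (simp add: add_subgroup_def L algebra_simps C_def)
    thus "(\<Sum>a\<in>UNIV. \<psi> (b * a + c * L a)) * gauss_sum \<chi> (- c)
        = (if c \<in> C then of_nat CARD('a) * gauss_sum \<chi> (- c) else 0)" by simp
  qed simp
  also have "\<dots> = of_nat CARD('a) * (\<Sum>c\<in>C. gauss_sum \<chi> (- c))"
    by (simp add: sum.If_cases sum_distrib_left)
  finally have "(\<Sum>a\<in>UNIV. \<chi> (L a) * \<psi> (b * a)) = (\<Sum>c\<in>C. gauss_sum \<chi> (- c))"
    by simp
  also have "cmod \<dots> \<le> card C * sqrt CARD('a)"
    by (rule sum_norm_bound) (rule cmod_gauss_sum[OF \<chi>])
  also have "\<dots> \<le> \<kappa> * sqrt CARD('a)"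
    using cardC by (intro mult_right_mono) auto
  finally show ?thesis .
qed

text \<open>The complete sum vanishes for \<open>b \<noteq> 0\<close>, so only the kernel
  contributes, with terms of modulus 1.\<close>

lemma punctured_sum_bound:
  fixes L :: "'a \<Rightarrow> 'a"
  assumes "b \<noteq> 0" and L: "\<And>x y. L (x + y) = L x + L y" and ker: "card {x. L x = 0} \<le> \<kappa>"
  shows "cmod (\<Sum>a\<in>UNIV. \<psi> (b * a) * of_bool (L a \<noteq> 0)) \<le> \<kappa>"
proof -
  have "(\<Sum>a\<in>UNIV. \<psi> (b * a) * of_bool (L a \<noteq> 0)) = (\<Sum>a\<in>UNIV. \<psi> (b * a)) - (\<Sum>a | L a = 0. \<psi> (b * a))"
    by (simp add: of_bool_def if_distrib sum.If_cases Compl_eq sum_diff[symmetric] set_diff_eq cong: if_cong)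
  also have "(\<Sum>a\<in>UNIV. \<psi> (b * a)) = 0"
    using sum_orthogonality[of b] assms(1) by (simp add: mult.commute)
  finally have "cmod (\<Sum>a\<in>UNIV. \<psi> (b * a) * of_bool (L a \<noteq> 0)) = cmod (\<Sum>a | L a = 0. \<psi> (b * a))"
    by simp
  also have "\<dots> \<le> of_nat (card {x. L x = 0}) * 1"
    by (rule sum_norm_bound) simp
  finally show ?thesis using ker by linarith
qed

section \<open>The sieve inequality\<close>

lemma sieved_element_exists:
  fixes L :: "'a \<Rightarrow> 'a" and E G :: "'a \<Rightarrow> complex"
  assumes L: "\<And>x y. L (x + y) = L x + L y" and ker: "card {x. L x = 0} \<le> \<kappa>"
    and P: "\<And>x. of_bool (P x) = of_real c * (1 + E x)"
    and E: "l1_comb {\<chi> \<in> chars. \<exists>x. \<chi> x \<noteq> 1} (s - 1) E"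
    and Q: "\<And>y. y \<noteq> 0 \<Longrightarrow> of_bool (Q y) = of_real d * (1 + G y)"
    and G: "l1_comb {\<chi> \<in> mult_chars. \<exists>x\<in>- {0}. \<chi> x \<noteq> 1} (t - 1) G"
    and "c \<noteq> 0" "d \<noteq> 0" "s \<ge> 1" "t \<ge> 1" "CARD('a) \<ge> s * t * (\<kappa> * sqrt CARD('a))"
  shows "\<exists>a. P a \<and> L a \<noteq> 0 \<and> Q (L a)"
proof (rule ccontr)
  assume none: "\<not> ?thesis"
  \<comment> \<open>The expansion of \<open>Q\<close> holds off 0 only; \<open>u\<close> restricts
    to that range and acts as the trivial multiplicative character composed with
    \<open>L\<close>.\<close>
  define u where "u = (\<lambda>a. of_bool (L a \<noteq> 0) :: complex)"
  define r where "r = sqrt CARD('a)"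
  have r: "r > 1" "r * r = CARD('a)"
    using card_mono[of UNIV "{0, 1 :: 'a}"] by (auto simp: r_def)
  have "L 0 = 0" using L[of 0 0] by (metis add_0 add_cancel_right_right)
  hence "card {x. L x = 0} > 0" by (auto simp: card_gt_0_iff)
  hence \<kappa>: "\<kappa> > 0" using ker by linarith
  have "(1 + E a) * (1 + G (L a)) * u a = 0" for a
  proof (cases "L a = 0")
    case False
    hence "of_bool (P a) * of_bool (Q (L a)) = (0 :: complex)" using none by auto
    thus ?thesis using P[of a] Q[OF False] assms(7,8) by auto
  qed (simp add: u_def)
  hence "0 = (\<Sum>a\<in>UNIV. (1 + E a) * (1 + G (L a)) * u a)"
    by (intro sum.neutral[symmetric]) blast
  \<comment> \<open>Terms without a nontrivial multiplicative character are split off because they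
    are bounded by \<open>\<kappa>\<close> instead of \<open>\<kappa> * r\<close>.\<close>
  also have "\<dots> = (\<Sum>a\<in>UNIV. u a) + ((\<Sum>a\<in>UNIV. E a * u a) + (\<Sum>a\<in>UNIV. G (L a) * ((1 + E a) * u a)))"
    by (simp add: algebra_simps sum.distrib)
  finally have "cmod (\<Sum>a\<in>UNIV. u a) = cmod ((\<Sum>a\<in>UNIV. E a * u a) + (\<Sum>a\<in>UNIV. G (L a) * ((1 + E a) * u a)))"
    by (metis add_eq_0_iff norm_minus_cancel)
  also have "\<dots> \<le> cmod (\<Sum>a\<in>UNIV. E a * u a) + cmod (\<Sum>a\<in>UNIV. G (L a) * ((1 + E a) * u a))"
    by (rule norm_triangle_ineq)
  also have "\<dots> \<le> (s - 1) * \<kappa> + (t - 1) * (s * (\<kappa> * r))"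
  proof (rule add_mono)
    have "cmod (\<Sum>a\<in>UNIV. \<chi> a * u a) \<le> \<kappa>" if \<chi>: "\<chi> \<in> {\<chi> \<in> chars. \<exists>x. \<chi> x \<noteq> 1}" for \<chi>
    proof -
      obtain b where b: "\<chi> = (\<lambda>x. \<psi> (b * x))" using \<chi> unfolding chars_def by blast
      with \<chi> have "b \<noteq> 0" by auto
      thus ?thesis using punctured_sum_bound[OF _ L ker] by (simp add: b u_def)
    qed
    thus "cmod (\<Sum>a\<in>UNIV. E a * u a) \<le> (s - 1) * \<kappa>"
      using l1_comb_bound[OF E, where A = UNIV and h = "\<lambda>a. a" and u = u and M = \<kappa>] by simp
  next
    show "cmod (\<Sum>a\<in>UNIV. G (L a) * ((1 + E a) * u a)) \<le> (t - 1) * (s * (\<kappa> * r))"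
    proof (rule l1_comb_bound[OF G])
      fix \<chi> :: "'a \<Rightarrow> complex"
      assume \<chi>: "\<chi> \<in> {\<chi> \<in> mult_chars. \<exists>x\<in>- {0}. \<chi> x \<noteq> 1}"
      \<comment> \<open>The weight is absorbed because \<open>\<chi> 0 = 0\<close>.\<close>
      hence \<chi>u: "\<chi> (L a) * u a = \<chi> (L a)" for a by (auto simp: u_def mult_chars_def)
      have mixed: "cmod (\<Sum>a\<in>UNIV. \<phi> a * \<chi> (L a)) \<le> \<kappa> * r" if "\<phi> \<in> chars" for \<phi>
      proof -
        obtain b where "\<phi> = (\<lambda>x. \<psi> (b * x))" using \<open>\<phi> \<in> chars\<close> unfolding chars_def by blast
        thus ?thesis using mixed_sum_bound[OF _ _ L ker, of \<chi> b] \<chi> by (simp add: r_def mult.commute)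
      qed
      have one: "(\<lambda>x. 1) \<in> chars"
        unfolding chars_def by (rule image_eqI[of _ _ 0]) auto
      have "cmod (\<Sum>a\<in>UNIV. E a * \<chi> (L a)) \<le> (s - 1) * (\<kappa> * r)"
        using l1_comb_bound[OF E, where A = UNIV and h = "\<lambda>a. a" and u = "\<lambda>a. \<chi> (L a)" and M = "\<kappa> * r"] mixed
        by blast
      moreover have "cmod (\<Sum>a\<in>UNIV. \<chi> (L a)) \<le> \<kappa> * r"
        using mixed[OF one] by simp
      moreover have "(\<Sum>a\<in>UNIV. \<chi> (L a) * ((1 + E a) * u a)) = (\<Sum>a\<in>UNIV. \<chi> (L a)) + (\<Sum>a\<in>UNIV. E a * \<chi> (L a))"
      proof -
        have "\<chi> (L a) * ((1 + E a) * u a) = \<chi> (L a) + E a * \<chi> (L a)" for a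
          using \<chi>u[of a] by (metis (no_types, lifting) distrib_left mult.assoc mult.commute mult.right_neutral)
        thus ?thesis by (simp add: sum.distrib)
      qed
      ultimately show "cmod (\<Sum>a\<in>UNIV. \<chi> (L a) * ((1 + E a) * u a)) \<le> s * (\<kappa> * r)"
        using norm_triangle_ineq[of "\<Sum>a\<in>UNIV. \<chi> (L a)" "\<Sum>a\<in>UNIV. E a * \<chi> (L a)"]
        by (simp add: left_diff_distrib)
    qed
  qed
  finally have upper: "cmod (\<Sum>a\<in>UNIV. u a) \<le> (s - 1) * \<kappa> + (t - 1) * (s * (\<kappa> * r))" .
  have "(\<Sum>a\<in>UNIV. u a) = of_nat (card {a. L a \<noteq> 0})"
    by (simp add: u_def)
  also have "card {a. L a \<noteq> 0} = CARD('a) - card {a. L a = 0}"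
    by (subst card_Diff_subset[symmetric]) (auto intro!: arg_cong[of _ _ card])
  finally have "cmod (\<Sum>a\<in>UNIV. u a) \<ge> CARD('a) - real \<kappa>"
    using ker by simp
  hence "CARD('a) \<le> s * \<kappa> + (t - 1) * (s * (\<kappa> * r))"
    using upper by (simp add: algebra_simps)
  \<comment> \<open>Subtract \<open>(t - 1) * (s * (\<kappa> * r))\<close> from the hypothesis on
    \<open>CARD('a)\<close>. What remains contradicts \<open>r > 1\<close>, even if that hypothesis
    is an equality.\<close>
  hence "s * (\<kappa> * r) \<le> s * \<kappa>"
    using assms(11) unfolding r_def[symmetric] by (simp add: algebra_simps)
  moreover have "s * \<kappa> > 0" using \<kappa> assms(9) by simp
  ultimately show False using r(1) mult_strict_left_mono[of 1 r "s * \<kappa>"] by (simp add: mult.assoc)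
qed

end

section \<open>Linearized associates over the subfield\<close>

text \<open>Multiplication by \<open>x\<close> permutes the nonzero elements, so it leaves their
  product unchanged.\<close>

lemma power_card_minus_1:
  fixes x :: "'a::{field,finite}"
  assumes "x \<noteq> 0"
  shows "x ^ (CARD('a) - 1) = 1"
proof -
  have bij: "bij_betw (\<lambda>y. x * y) (- {0}) (- {0})"
    by (rule bij_betw_byWitness[where f' = "\<lambda>y. y / x"]) (use assms in auto)
  have "\<Prod>(- {0 :: 'a}) = (\<Prod>y\<in>- {0}. x * y)"
    using prod.reindex_bij_betw[OF bij, of "\<lambda>y. y"] by simp
  also have "\<dots> = x ^ (CARD('a) - 1) * \<Prod>(- {0})"
    by (simp add: prod.distrib Compl_eq_Diff_UNIV card_Diff_subset)
  finally show ?thesis by simp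
qed

lemma power_card_eq_same:
  fixes x :: "'a::{field,finite}"
  shows "x ^ CARD('a) = x"
proof (cases "x = 0")
  case False
  have "x ^ CARD('a) = x * x ^ (CARD('a) - 1)"
    by (subst power_Suc[symmetric]) simp
  thus ?thesis using power_card_minus_1[OF False] by simp
qed simp

text \<open>Instantiated twice: with the \<open>q\<close> of the theorem, and with the
  characteristic, where a linearized associate is the absolute trace.\<close>

locale frobenius_power =
  fixes q :: nat and field_type :: "'a::{field,finite} itself"
  assumes q_gt_1: "q > 1"
    and frob: "(x + y :: 'a) ^ q = x ^ q + y ^ q"
begin

lemma frob_iter: "(x + y :: 'a) ^ (q ^ i) = x ^ (q ^ i) + y ^ (q ^ i)"
  by (induction i arbitrary: x y) (simp_all add: power_mult frob)

lemma frob_sum: "(sum f A :: 'a) ^ q = (\<Sum>i\<in>A. f i ^ q)"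
  using q_gt_1 by (induction A rule: infinite_finite_induct) (auto simp: frob power_0_left)

lemma frob_minus: "(- x :: 'a) ^ q = - (x ^ q)"
proof -
  have "x ^ q + (- x) ^ q = (0::'a)" using frob[of x "- x"] q_gt_1 by (simp add: power_0_left)
  thus ?thesis by (simp add: eq_neg_iff_add_eq_0 add.commute)
qed

lemma Lq_altdef:
  assumes "degree h \<le> N"
  shows "Lq q h (x :: 'a) = (\<Sum>i\<le>N. coeff h i * x ^ (q ^ i))"
  unfolding Lq_def using assms
  by (intro sum.mono_neutral_left) (auto simp: coeff_eq_0)

lemma Lq_add_right: "Lq q h (x + y :: 'a) = Lq q h x + Lq q h y"
  by (simp add: Lq_def frob_iter distrib_left sum.distrib)

lemma Lq_0 [simp]: "Lq q 0 (x :: 'a) = 0"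
  by (simp add: Lq_def)

lemma Lq_1 [simp]: "Lq q 1 (x :: 'a) = x"
  by (simp add: Lq_def)

lemma Lq_0_right [simp]: "Lq q h (0 :: 'a) = 0"
  using q_gt_1 by (simp add: Lq_def power_0_left)

lemma Lq_add: "Lq q (g + h) (x :: 'a) = Lq q g x + Lq q h x"
  using degree_add_le_max[of g h]
  by (simp add: Lq_altdef[where N = "max (degree g) (degree h)"] sum.distrib algebra_simps)

lemma Lq_smult: "Lq q (smult c h) (x :: 'a) = c * Lq q h x"
  by (simp add: Lq_altdef[where N = "degree h"] sum_distrib_left mult.assoc degree_smult_le)

lemma Lq_diff: "Lq q (g - h) (x :: 'a) = Lq q g x - Lq q h x"
  using Lq_add[of g "- h" x] Lq_smult[of "-1" h x] by simp

lemma Lq_monom: "Lq q (monom 1 n) (x :: 'a) = x ^ (q ^ n)"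
proof -
  have "Lq q (monom 1 n) x = (\<Sum>i\<le>n. if n = i then x ^ (q ^ i) else 0)"
    by (subst Lq_altdef[OF degree_monom_le], rule sum.cong) auto
  thus ?thesis by simp
qed

lemma Lq_pCons: "Lq q (pCons a h) (x :: 'a) = a * x + Lq q h (x ^ q)"
proof -
  have "Lq q (pCons a h) x = (\<Sum>i\<le>Suc (degree h). coeff (pCons a h) i * x ^ (q ^ i))"
    by (rule Lq_altdef[OF degree_pCons_le])
  also have "\<dots> = a * x + (\<Sum>i\<le>degree h. coeff h i * x ^ (q * q ^ i))"
    unfolding sum.atMost_Suc_shift by simp
  finally show ?thesis by (simp add: Lq_def power_mult)
qed

lemma Lq_frob:
  assumes "Fq_poly q g"
  shows "Lq q g (x ^ q :: 'a) = Lq q g x ^ q"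
  using assms
  by (simp add: Lq_def frob_sum power_mult_distrib Fq_poly_def Fq_def mult.commute flip: power_mult)

text \<open>Induction on \<open>h\<close>: a factor x on the left becomes a q-th power of the
  argument, which passes through \<open>Lq q g\<close> because the coefficients of \<open>g\<close>
  are fixed by that power.\<close>

lemma Lq_mult:
  assumes "Fq_poly q g"
  shows "Lq q (h * g) (x :: 'a) = Lq q h (Lq q g x)"
proof (induction h arbitrary: x)
  case 0
  then show ?case by simp
next
  case (pCons a h)
  have "Lq q (pCons a h * g) x = a * Lq q g x + Lq q h (Lq q g x ^ q)"
    using pCons.IH[of "x ^ q"] Lq_frob[OF assms, of x]
    by (simp add: mult_pCons_left Lq_add Lq_smult Lq_pCons)
  thus ?case by (simp add: Lq_pCons)
qed

text \<open>The map is the value of an ordinary polynomial whose exponents \<open>q ^ i\<close> are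
  distinct, so the leading coefficient of \<open>h\<close> survives at degree
  \<open>q ^ degree h\<close>.\<close>

lemma card_kernel_Lq:
  assumes "h \<noteq> 0"
  shows "card {x :: 'a. Lq q h x = 0} \<le> q ^ degree h"
proof -
  define p where "p = (\<Sum>i\<le>degree h. monom (coeff h i) (q ^ i))"
  have "coeff p (q ^ degree h) = (\<Sum>i\<le>degree h. if i = degree h then coeff h i else 0)"
    unfolding p_def coeff_sum using q_gt_1 by (intro sum.cong) auto
  also have "\<dots> = lead_coeff h" by simp
  finally have "p \<noteq> 0" using assms by auto
  moreover have "degree p \<le> q ^ degree h"
    unfolding p_def using q_gt_1
    by (intro degree_sum_le) (auto intro!: order.trans[OF degree_monom_le] power_increasing)
  moreover have "poly p x = Lq q h x" for x
    by (simp add: p_def Lq_def poly_sum poly_monom)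
  ultimately show ?thesis using card_poly_roots_bound[of p] by simp
qed

lemma Lq_nonzero_value:
  assumes "h \<noteq> 0" "q ^ degree h < CARD('a)"
  shows "\<exists>x :: 'a. Lq q h x \<noteq> 0"
proof (rule ccontr)
  assume "\<not> ?thesis"
  hence "{x :: 'a. Lq q h x = 0} = UNIV" by auto
  thus False using card_kernel_Lq[OF assms(1)] assms(2) by simp
qed

subsection \<open>Divisibility over the subfield\<close>

text \<open>Its fixed points are the polynomials over the subfield, so closure properties of
  \<open>Fq_poly\<close> follow from its being a ring homomorphism.\<close>

definition frob_poly :: "'a poly \<Rightarrow> 'a poly" where
  "frob_poly = map_poly (\<lambda>x. x ^ q)"

lemma coeff_frob_poly [simp]: "coeff (frob_poly h) i = coeff h i ^ q"
  unfolding frob_poly_def using q_gt_1 by (subst coeff_map_poly) (auto simp: power_0_left)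

lemma frob_poly_eq_iff: "Fq_poly q h \<longleftrightarrow> frob_poly h = h"
  by (simp add: Fq_poly_def Fq_def poly_eq_iff)

lemma frob_poly_add: "frob_poly (g + h) = frob_poly g + frob_poly h"
  by (simp add: poly_eq_iff frob)

lemma frob_poly_mult: "frob_poly (g * h) = frob_poly g * frob_poly h"
  by (simp add: poly_eq_iff coeff_mult frob_sum power_mult_distrib)

lemma degree_frob_poly [simp]: "degree (frob_poly h) = degree h"
  using q_gt_1 unfolding frob_poly_def by (intro degree_map_poly) auto

lemma frob_poly_0 [simp]: "frob_poly 0 = 0"
  by (simp add: frob_poly_def)

lemma Fq_poly_0 [simp]: "Fq_poly q (0 :: 'a poly)"
  by (simp add: frob_poly_eq_iff)

lemma Fq_poly_1 [simp]: "Fq_poly q (1 :: 'a poly)"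
  using q_gt_1 by (auto simp: Fq_poly_def Fq_def coeff_1 power_0_left)

lemma Fq_poly_monom [simp]: "Fq_poly q (monom 1 n :: 'a poly)"
  using q_gt_1 by (auto simp: Fq_poly_def Fq_def power_0_left)

lemma Fq_poly_add: "Fq_poly q g \<Longrightarrow> Fq_poly q h \<Longrightarrow> Fq_poly q (g + h :: 'a poly)"
  by (simp add: frob_poly_eq_iff frob_poly_add)

lemma Fq_poly_mult: "Fq_poly q g \<Longrightarrow> Fq_poly q h \<Longrightarrow> Fq_poly q (g * h :: 'a poly)"
  by (simp add: frob_poly_eq_iff frob_poly_mult)

lemma Fq_poly_minus: "Fq_poly q h \<Longrightarrow> Fq_poly q (- h :: 'a poly)"
  by (simp add: Fq_poly_def Fq_def frob_minus)

lemma Fq_poly_diff: "Fq_poly q g \<Longrightarrow> Fq_poly q h \<Longrightarrow> Fq_poly q (g - h :: 'a poly)"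
  using Fq_poly_add[of g "- h"] Fq_poly_minus[of h] by simp

lemma Fq_poly_prod: "(\<And>P. P \<in> I \<Longrightarrow> Fq_poly q P) \<Longrightarrow> Fq_poly q (\<Prod>I :: 'a poly)"
  by (induction I rule: infinite_finite_induct) (auto intro: Fq_poly_mult)

lemma Fq_poly_monic_smult:
  assumes "Fq_poly q h"
  shows "Fq_poly q (smult (inverse (lead_coeff h)) h :: 'a poly)"
  using assms by (simp add: Fq_poly_def Fq_def power_mult_distrib power_inverse)

text \<open>Frobenius maps a quotient with remainder to a quotient with remainder, which is unique.\<close>
lemma Fq_poly_div_mod:
  assumes "Fq_poly q g" "Fq_poly q h"
  shows "Fq_poly q (g div h :: 'a poly)" and "Fq_poly q (g mod h :: 'a poly)"
proof -
  have "g = frob_poly (g div h * h + g mod h)"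
    using assms(1) by (simp add: frob_poly_eq_iff)
  also have "\<dots> = frob_poly (g div h) * h + frob_poly (g mod h)"
    using assms(2) by (simp only: frob_poly_add frob_poly_mult frob_poly_eq_iff)
  finally have g: "g = frob_poly (g div h) * h + frob_poly (g mod h)" .
  have "(g div h, g mod h) = (frob_poly (g div h), frob_poly (g mod h))"
  proof (rule euclidean_relation_polyI)
    assume "h \<noteq> 0" "h dvd g"
    thus "frob_poly (g mod h) = 0 \<and> g = frob_poly (g div h) * h" using g by simp
  next
    assume "h \<noteq> 0" "\<not> h dvd g"
    thus "degree (frob_poly (g mod h)) < degree h \<and> g = frob_poly (g div h) * h + frob_poly (g mod h)"
      using g degree_mod_less'[of h g] by (auto simp: mod_eq_0_iff_dvd)
  qed (use assms(1) in \<open>auto simp: frob_poly_eq_iff\<close>)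
  thus "Fq_poly q (g div h)" "Fq_poly q (g mod h)"
    by (simp_all add: frob_poly_eq_iff)
qed

lemma Fq_dvd_iff: "Fq_dvd q h (g :: 'a poly) \<longleftrightarrow> Fq_poly q h \<and> Fq_poly q g \<and> h dvd g"
  unfolding Fq_dvd_def by (metis Fq_poly_div_mod(1) dvd_div_mult_self dvd_triv_left mult.commute)

lemma monic_Fq_divisors_iff:
  "h \<in> monic_Fq_divisors q (g :: 'a poly) \<longleftrightarrow> lead_coeff h = 1 \<and> Fq_poly q h \<and> Fq_poly q g \<and> h dvd g"
  by (simp add: monic_Fq_divisors_def Fq_dvd_iff)

section \<open>Monic irreducible polynomials over the subfield\<close>

definition Fq_prime :: "'a poly \<Rightarrow> bool" where
  "Fq_prime P \<longleftrightarrow> Fq_poly q P \<and> lead_coeff P = 1 \<and> degree P > 0 \<and>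
     (\<forall>h\<in>monic_Fq_divisors q P. h = 1 \<or> h = P)"

text \<open>An element of least degree in the ideal generated by \<open>P\<close> and
  \<open>h\<close> over the subfield divides both; remainders stay in the ideal by
  \<open>Fq_poly_div_mod\<close>.\<close>

lemma Fq_bezout:
  assumes P: "Fq_prime P" and h: "Fq_poly q h" "\<not> P dvd h"
  shows "\<exists>u v. Fq_poly q u \<and> Fq_poly q v \<and> P * u + h * v = 1"
proof -
  define I where "I = {P * u + h * v | u v. Fq_poly q u \<and> Fq_poly q v}"
  have FP: "Fq_poly q P" and P0: "P \<noteq> 0" using P by (auto simp: Fq_prime_def)
  have I_mult: "a * s \<in> I" if "a \<in> I" "Fq_poly q s" for a s
  proof -
    obtain u v where "a = P * u + h * v" "Fq_poly q u" "Fq_poly q v" using \<open>a \<in> I\<close> I_def by auto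
    hence "a * s = P * (u * s) + h * (v * s)" "Fq_poly q (u * s)" "Fq_poly q (v * s)"
      using that by (auto simp: algebra_simps Fq_poly_mult)
    thus ?thesis unfolding I_def by blast
  qed
  have I_diff: "a - b \<in> I" if ab: "a \<in> I" "b \<in> I" for a b
  proof -
    obtain u v where "a = P * u + h * v" "Fq_poly q u" "Fq_poly q v" using ab I_def by auto
    moreover obtain u' v' where "b = P * u' + h * v'" "Fq_poly q u'" "Fq_poly q v'" using ab I_def by auto
    ultimately have "a - b = P * (u - u') + h * (v - v')" "Fq_poly q (u - u')" "Fq_poly q (v - v')"
      by (auto simp: algebra_simps Fq_poly_diff)
    thus ?thesis unfolding I_def by blast
  qed
  have FI: "Fq_poly q a" if "a \<in> I" for a
    using that FP h by (auto simp: I_def intro: Fq_poly_add Fq_poly_mult)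
  have "P * 1 + h * 0 \<in> I" "P * 0 + h * 1 \<in> I"
    unfolding I_def using Fq_poly_0 Fq_poly_1 by blast+
  hence PI: "P \<in> I" and hI: "h \<in> I" by simp_all
  obtain d where d: "d \<in> I" "d \<noteq> 0" and min: "\<And>e. e \<in> I \<Longrightarrow> e \<noteq> 0 \<Longrightarrow> degree d \<le> degree e"
    using ex_has_least_nat[of "\<lambda>d. d \<in> I \<and> d \<noteq> 0" P degree] PI P0 by blast
  have d_dvd: "d dvd a" if "a \<in> I" for a
  proof -
    have "a mod d = a - d * (a div d)" by (simp add: minus_mult_div_eq_mod)
    hence "a mod d \<in> I"
      using I_diff[OF that I_mult[OF d(1) Fq_poly_div_mod(1)[OF FI[OF that] FI[OF d(1)]]]] by simp
    hence "a mod d = 0" using degree_mod_less[OF d(2), of a] min[of "a mod d"] by fastforce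
    thus ?thesis by (simp add: mod_eq_0_iff_dvd)
  qed
  \<comment> \<open>Once monic, the generator is a divisor of \<open>P\<close> in the sense of
    \<open>Fq_prime\<close>, and it cannot be \<open>P\<close>, since it divides
    \<open>h\<close>.\<close>
  define d' where "d' = smult (inverse (lead_coeff d)) d"
  have "d' \<in> monic_Fq_divisors q P"
    using d d_dvd[OF PI] FP Fq_poly_monic_smult[OF FI[OF d(1)]]
    by (auto simp: monic_Fq_divisors_iff d'_def smult_dvd_iff)
  moreover have "d' \<noteq> P"
    using d_dvd[OF hI] h(2) d(2) by (auto simp: d'_def smult_dvd_iff)
  ultimately have "d' = 1" using P by (auto simp: Fq_prime_def)
  moreover have "d' \<in> I"
  proof -
    have "Fq_poly q [:inverse (lead_coeff d):]"
      using FI[OF d(1)] q_gt_1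
      by (auto simp: Fq_poly_def Fq_def coeff_pCons power_inverse power_0_left split: nat.splits)
    from I_mult[OF d(1) this] show ?thesis by (simp add: d'_def)
  qed
  ultimately show ?thesis unfolding I_def by auto
qed

lemma Fq_prime_dvd_mult:
  assumes P: "Fq_prime P" and "Fq_poly q g" "Fq_poly q h" "P dvd g * h"
  shows "P dvd g \<or> P dvd h"
proof (rule disjCI)
  assume "\<not> P dvd h"
  then obtain u v where uv: "P * u + h * v = 1" using Fq_bezout[OF P assms(3)] by blast
  have "g = P * (u * g) + (g * h) * v"
    using arg_cong[OF uv, of "\<lambda>t. t * g"] by (simp add: algebra_simps)
  thus "P dvd g" using assms(4) by (metis dvd_add dvd_mult2 dvd_triv_left)
qed

lemma Fq_prime_dvd_prime:
  assumes "Fq_prime P" "Fq_prime Q" "P dvd Q"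
  shows "P = Q"
proof -
  have "P \<in> monic_Fq_divisors q Q" using assms by (auto simp: Fq_prime_def monic_Fq_divisors_iff)
  thus ?thesis using assms(1,2) unfolding Fq_prime_def by (metis degree_1 less_irrefl)
qed

lemma Fq_prime_dvd_prod:
  assumes P: "Fq_prime P" and "finite I" "\<And>Q. Q \<in> I \<Longrightarrow> Fq_prime Q" "P dvd \<Prod>I"
  shows "P \<in> I"
  using assms(2-)
proof (induction I)
  case empty
  hence "is_unit P" by simp
  hence "degree P = 0" by (auto simp: is_unit_poly_iff)
  thus ?case using P by (simp add: Fq_prime_def)
next
  case (insert Q I)
  have F: "Fq_poly q R" if "R \<in> insert Q I" for R using insert.prems(1)[OF that] by (simp add: Fq_prime_def)
  have "P dvd Q \<or> P dvd \<Prod>I"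
    using insert.prems insert.hyps F by (intro Fq_prime_dvd_mult[OF P] Fq_poly_prod) auto
  thus ?case using insert.IH insert.prems(1) Fq_prime_dvd_prime[OF P, of Q] by auto
qed

lemma prod_Fq_primes_dvd:
  assumes "finite I" "\<And>P. P \<in> I \<Longrightarrow> Fq_prime P \<and> P dvd T" "Fq_poly q T"
  shows "\<Prod>I dvd T"
  using assms(1,2)
proof (induction I)
  case (insert P I)
  have FI: "Fq_poly q (\<Prod>I)"
    using insert.prems by (intro Fq_poly_prod) (auto simp: Fq_prime_def)
  have T: "T = \<Prod>I * (T div \<Prod>I)" using insert by simp
  have P: "Fq_prime P" and PT: "P dvd \<Prod>I * (T div \<Prod>I)" using insert.prems[of P] T by auto
  have "P dvd \<Prod>I \<or> P dvd T div \<Prod>I"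
    by (rule Fq_prime_dvd_mult[OF P FI Fq_poly_div_mod(1)[OF assms(3) FI] PT])
  moreover have "\<not> P dvd \<Prod>I"
    using Fq_prime_dvd_prod[OF P insert.hyps(1)] insert.prems insert.hyps(2) by auto
  ultimately have "P * \<Prod>I dvd (T div \<Prod>I) * \<Prod>I" by (intro mult_dvd_mono) auto
  thus ?case using insert.hyps T by (simp add: mult.commute)
qed simp

text \<open>A nonconstant monic divisor of least degree has no proper nonconstant divisor.\<close>

lemma ex_Fq_prime_dvd:
  assumes "Fq_poly q h" "degree h > 0"
  shows "\<exists>P. Fq_prime P \<and> P dvd h"
proof -
  let ?D = "\<lambda>P. P \<in> monic_Fq_divisors q h \<and> degree P > 0"
  have "?D (smult (inverse (lead_coeff h)) h)"
    using assms Fq_poly_monic_smult[OF assms(1)]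
    by (auto simp: monic_Fq_divisors_iff smult_dvd_iff)
  then obtain P where P: "?D P" and min: "\<And>Q. ?D Q \<Longrightarrow> degree P \<le> degree Q"
    using ex_has_least_nat[of ?D _ degree] by blast
  have "g = 1 \<or> g = P" if g: "g \<in> monic_Fq_divisors q P" for g
  proof (cases "degree g = 0")
    case True
    then obtain c where "g = [:c:]" by (rule degree_eq_zeroE)
    thus ?thesis using g by (simp add: monic_Fq_divisors_iff one_pCons)
  next
    case False
    hence "?D g" using g P by (auto simp: monic_Fq_divisors_iff intro: dvd_trans)
    hence deg: "degree P \<le> degree g" by (rule min)
    obtain r where r: "P = g * r" using g by (auto simp: monic_Fq_divisors_iff elim: dvdE)
    have "g \<noteq> 0" "r \<noteq> 0" using P r by auto
    hence "degree r = 0" using deg r by (simp add: degree_mult_eq)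
    then obtain c where c: "r = [:c:]" by (rule degree_eq_zeroE)
    have "lead_coeff P = 1" "lead_coeff g = 1" using P g by (auto simp: monic_Fq_divisors_iff)
    hence "lead_coeff r = 1" using r by (metis lead_coeff_mult mult_1)
    hence "c = 1" using c by simp
    thus ?thesis using r c by simp
  qed
  hence "Fq_prime P" using P unfolding Fq_prime_def by (simp add: monic_Fq_divisors_iff)
  thus ?thesis using P by (auto simp: monic_Fq_divisors_iff)
qed

section \<open>Square-free divisors, freeness and images through irreducible factors\<close>

definition Fq_prime_divisors :: "'a poly \<Rightarrow> 'a poly set" where
  "Fq_prime_divisors T = {P. Fq_prime P \<and> P dvd T}"

lemma finite_dvd:
  assumes "T \<noteq> (0 :: 'a poly)"
  shows "finite {h. h dvd T}"
proof -
  have "{h. h dvd T} \<subseteq> Poly ` {xs. set xs \<subseteq> UNIV \<and> length xs \<le> Suc (degree T)}"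
  proof safe
    fix h assume "h dvd T"
    hence "degree h \<le> degree T" by (rule dvd_imp_degree_le[OF _ assms])
    hence "length (coeffs h) \<le> Suc (degree T)"
      by (cases "h = 0") (simp_all add: length_coeffs_degree)
    thus "h \<in> Poly ` {xs. set xs \<subseteq> UNIV \<and> length xs \<le> Suc (degree T)}"
      by (intro image_eqI[of _ _ "coeffs h"]) auto
  qed
  thus ?thesis by (rule finite_subset) (intro finite_imageI finite_lists_length_le finite)
qed

lemma finite_Fq_prime_divisors: "T \<noteq> 0 \<Longrightarrow> finite (Fq_prime_divisors T)"
  unfolding Fq_prime_divisors_def by (rule finite_subset[OF _ finite_dvd]) auto

text \<open>Sets of prime divisors inject into square-free divisors by taking products. This
  direction lets the hypothesis on W bound the cost of the sieve.\<close>

lemma W_poly_ge: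
  assumes T: "Fq_poly q T" "T \<noteq> 0"
  shows "2 ^ card (Fq_prime_divisors T) \<le> W_poly q T"
proof -
  define S where "S = Fq_prime_divisors T"
  have fin: "finite S" unfolding S_def using T(2) by (rule finite_Fq_prime_divisors)
  have S: "Fq_prime P" "P dvd T" if "P \<in> S" for P using that by (auto simp: S_def Fq_prime_divisors_def)
  have mem: "P \<in> I" if "I \<subseteq> S" "P \<in> S" "P dvd \<Prod>I" for P I
    using that finite_subset[OF that(1) fin] S by (intro Fq_prime_dvd_prod[of P I]) auto
  have dvd: "P dvd \<Prod>I" if "I \<subseteq> S" "P \<in> I" for P I
    using that finite_subset[OF that(1) fin] by (metis dvd_prod_eqI)
  have "{P \<in> S. P dvd \<Prod>I} = I" if "I \<in> Pow S" for I
    using that mem[of I] dvd[of I] by blast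
  hence "inj_on (\<lambda>I. \<Prod>I) (Pow S)"
    by (rule inj_on_inverseI[where g = "\<lambda>h. {P \<in> S. P dvd h}"])
  moreover have "(\<lambda>I. \<Prod>I) ` Pow S \<subseteq> {h \<in> monic_Fq_divisors q T. Fq_squarefree q h}"
  proof safe
    fix I assume I: "I \<subseteq> S"
    have finI: "finite I" using I fin by (rule finite_subset)
    have F: "Fq_poly q (\<Prod>I)" using I S by (intro Fq_poly_prod) (auto simp: Fq_prime_def)
    have lead: "lead_coeff (\<Prod>I) = 1"
      unfolding lead_coeff_prod using I S by (intro prod.neutral) (auto simp: Fq_prime_def)
    thus "\<Prod>I \<in> monic_Fq_divisors q T"
      using F T(1) prod_Fq_primes_dvd[OF finI _ T(1)] I S by (auto simp: monic_Fq_divisors_iff)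
    have "degree g = 0" if g: "Fq_poly q g" "g ^ 2 dvd \<Prod>I" for g
    proof (rule ccontr)
      assume "degree g \<noteq> 0"
      then obtain P where P: "Fq_prime P" "P dvd g" using ex_Fq_prime_dvd[OF g(1)] by auto
      hence P2: "P * P dvd \<Prod>I"
        using g(2) by (metis dvd_trans mult_dvd_mono power2_eq_square)
      have PI: "P \<in> I"
        using Fq_prime_dvd_prod[OF P(1) finI] I S dvd_trans[OF dvd_triv_left P2] by auto
      \<comment> \<open>Cancelling one \<open>P\<close> makes it divide a product of primes
        different from it.\<close>
      hence "\<Prod>I = P * \<Prod>(I - {P})" using finI by (simp add: prod.remove)
      hence "P dvd \<Prod>(I - {P})"
        using P2 P(1) by (auto simp: Fq_prime_def)
      thus False using Fq_prime_dvd_prod[OF P(1), of "I - {P}"] finI I S by auto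
    qed
    thus "Fq_squarefree q (\<Prod>I)"
      using lead by (auto simp: Fq_squarefree_def Fq_dvd_iff)
  qed
  moreover have "finite {h \<in> monic_Fq_divisors q T. Fq_squarefree q h}"
    by (rule finite_subset[OF _ finite_dvd[OF T(2)]]) (auto simp: monic_Fq_divisors_iff)
  ultimately have "card (Pow S) \<le> W_poly q T"
    unfolding W_poly_def by (rule card_inj_on_le)
  thus ?thesis using fin by (simp add: card_Pow S_def)
qed

text \<open>A divisor \<open>h \<noteq> 1\<close> has a prime factor \<open>P\<close>, and
  \<open>Lq q h\<close> factors through \<open>Lq q P\<close>.\<close>

lemma M_free_if_avoids_prime_images:
  assumes "\<forall>P\<in>Fq_prime_divisors T. \<alpha> \<notin> range (Lq q P)"
  shows "M_free q T \<alpha>"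
  unfolding M_free_def
proof safe
  fix h \<beta> assume h: "h \<in> monic_Fq_divisors q T" and \<alpha>: "\<alpha> = Lq q h \<beta>"
  show "h = 1"
  proof (rule ccontr)
    assume "h \<noteq> 1"
    hence "degree h > 0" using h
      by (metis degree_eq_zeroE gr0I lead_coeff_pCons(2) monic_Fq_divisors_iff one_pCons pCons_0_0 zero_neq_one)
    then obtain P where P: "Fq_prime P" "P dvd h"
      using ex_Fq_prime_dvd h by (auto simp: monic_Fq_divisors_iff)
    hence "h = P * (h div P)" "Fq_poly q (h div P)"
      using h Fq_poly_div_mod(1) by (auto simp: monic_Fq_divisors_iff Fq_prime_def)
    hence "\<alpha> = Lq q P (Lq q (h div P) \<beta>)" using \<alpha> Lq_mult by metis
    moreover have "P \<in> Fq_prime_divisors T"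
      using P h by (auto simp: Fq_prime_divisors_def monic_Fq_divisors_iff intro: dvd_trans)
    ultimately show False using assms by blast
  qed
qed

text \<open>Apply the linearized form of a Bezout identity for \<open>P\<close> and
  \<open>\<Prod>I\<close> to \<open>x\<close>. An additive character trivial on both images is then
  trivial, as \<open>gen\<close> in \<open>sieve_expansion\<close> demands.\<close>

lemma prime_images_generate:
  assumes P: "P \<in> Fq_prime_divisors T" and I: "I \<subseteq> Fq_prime_divisors T" "P \<notin> I" and T: "T \<noteq> 0"
  shows "\<exists>y z. x = y + z \<and> y \<in> range (Lq q P) \<and> z \<in> (\<Inter>Q\<in>I. range (Lq q Q))"
proof -
  have fin: "finite I" using I finite_Fq_prime_divisors[OF T] finite_subset by blast
  have prime: "Fq_prime Q" if "Q \<in> insert P I" for Q using that P I by (auto simp: Fq_prime_divisors_def)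
  have F: "Fq_poly q (\<Prod>J)" if "J \<subseteq> I" for J
    using that prime by (intro Fq_poly_prod) (auto simp: Fq_prime_def)
  have "\<not> P dvd \<Prod>I" using Fq_prime_dvd_prod[OF _ fin, of P] prime I(2) by blast
  then obtain u v where uv: "Fq_poly q u" "Fq_poly q v" "P * u + \<Prod>I * v = 1"
    using Fq_bezout[of P "\<Prod>I"] prime F by blast
  have "x = Lq q (P * u + \<Prod>I * v) x" using uv(3) by simp
  also have "\<dots> = Lq q P (Lq q u x) + Lq q (\<Prod>I * v) x"
    unfolding Lq_add using uv(1) by (simp only: Lq_mult)
  finally have "x = Lq q P (Lq q u x) + Lq q (\<Prod>I * v) x" .
  moreover have "Lq q (\<Prod>I * v) x \<in> range (Lq q Q)" if Q: "Q \<in> I" for Q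
  proof -
    have "\<Prod>I * v = Q * (\<Prod>(I - {Q}) * v)" using prod.remove[OF fin Q, of "\<lambda>x. x"] by (simp add: mult.assoc)
    moreover have "Fq_poly q (\<Prod>(I - {Q}) * v)" using F[of "I - {Q}"] uv(2) by (auto intro: Fq_poly_mult)
    ultimately show ?thesis by (metis Lq_mult rangeI)
  qed
  ultimately show ?thesis by blast
qed

text \<open>With \<open>X = h * g\<close>, the composition of the two associates is
  \<open>x ^ (q ^ n) - x\<close>, which is 0. Were \<open>Lq q h\<close> onto, it would be injective
  and \<open>Lq q g\<close> would vanish identically, too often for its degree.\<close>

lemma range_Lq_proper:
  assumes n: "CARD('a) = q ^ n" and h: "h dvd monom 1 n - 1" "Fq_poly q h" "degree h > 0" and "n > 0"
  shows "range (Lq q h) \<noteq> (UNIV :: 'a set)"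
proof
  assume surj: "range (Lq q h) = (UNIV :: 'a set)"
  hence inj: "inj (Lq q h :: 'a \<Rightarrow> 'a)" by (simp add: finite_UNIV_surj_inj)
  define X where "X = (monom 1 n - 1 :: 'a poly)"
  have X: "Fq_poly q X" by (simp add: X_def Fq_poly_diff)
  have degX: "degree X = n"
    using degree_add_eq_left[of "-1" "monom (1::'a) n"] \<open>n > 0\<close> by (simp add: X_def degree_monom_eq)
  obtain g where g: "X = h * g" using h(1) unfolding X_def by (rule dvdE)
  have "X \<noteq> 0" using degX \<open>n > 0\<close> by auto
  hence hg: "h \<noteq> 0" "g \<noteq> 0" using g by auto
  have Fg: "Fq_poly q g"
    using Fq_poly_div_mod(1)[OF X h(2)] g hg by simp
  have "Lq q X x = 0" for x :: 'a
    using power_card_eq_same[of x] by (simp add: X_def Lq_diff Lq_monom n)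
  hence "Lq q h (Lq q g x) = Lq q h 0" for x :: 'a
    using Lq_mult[OF Fg, of h x] g by simp
  hence "Lq q g x = 0" for x :: 'a using inj by (meson injD)
  moreover have "q ^ degree g < CARD('a)"
    using degX g hg h(3) q_gt_1 unfolding n by (auto simp: degree_mult_eq)
  ultimately show False using Lq_nonzero_value[OF hg(2)] by blast
qed

end

section \<open>Existence of characters\<close>

lemma root_of_unity_power_eq_1_iff:
  assumes "r > 0"
  shows "cis (2 * pi / real r) ^ j = 1 \<longleftrightarrow> r dvd j"
proof
  assume "cis (2 * pi / real r) ^ j = 1"
  hence "cos (real j * (2 * pi / real r)) = 1"
    by (metis DeMoivre cis.simps(1) one_complex.simps(1))
  then obtain n :: int where "real j * (2 * pi / real r) = of_int n * 2 * pi"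
    unfolding cos_one_2pi_int by blast
  hence "real j = of_int n * real r" using assms by (simp add: field_simps)
  hence "of_int (int j) = (of_int (n * int r) :: real)" by simp
  hence "int j = n * int r" by (simp only: of_int_eq_iff)
  thus "r dvd j" by (metis dvd_triv_right int_dvd_int_iff)
next
  assume "r dvd j"
  then obtain k where "j = r * k" by (rule dvdE)
  thus "cis (2 * pi / real r) ^ j = 1"
    using assms by (simp add: power_mult DeMoivre)
qed

lemma root_of_unity_power_cong:
  assumes "r > 0" "[a = b] (mod r)"
  shows "cis (2 * pi / real r) ^ a = cis (2 * pi / real r) ^ b"
proof -
  have "cis (2 * pi / real r) ^ a = cis (2 * pi / real r) ^ (a mod r)" for a
  proof -
    have "cis (2 * pi / real r) ^ a = cis (2 * pi / real r) ^ (r * (a div r) + a mod r)" by simp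
    thus ?thesis
      unfolding power_add using root_of_unity_power_eq_1_iff[OF assms(1), of "r * (a div r)"] by simp
  qed
  thus ?thesis using assms(2) unfolding cong_def by metis
qed

lemma ex_field_generator: "\<exists>g :: 'a::{field,finite}. \<forall>x. x \<noteq> 0 \<longrightarrow> (\<exists>i. x = g ^ i)"
proof -
  \<comment> \<open>The type is repackaged as a record so that cyclicity of the unit group of a
    finite field can be applied.\<close>
  define R :: "'a ring" where
    "R = \<lparr>carrier = UNIV, monoid.mult = (*), one = 1, ring.zero = 0, add = (+)\<rparr>"
  have inverses: "\<exists>y. x + y = 0" "x \<noteq> 0 \<Longrightarrow> \<exists>y. x * y = 1" for x :: 'a
    by (auto intro: exI[of _ "- x"] exI[of _ "inverse x"])
  interpret R: field R
    by unfold_locales (use inverses in \<open>auto simp: R_def algebra_simps Units_def\<close>)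
  have pow: "x [^]\<^bsub>R\<^esub> i = x ^ i" for x :: 'a and i :: nat
    by (induction i) (simp_all add: R_def mult.commute)
  obtain g where "carrier (mult_of R) = {g [^]\<^bsub>R\<^esub> i | i :: nat. i \<in> UNIV}"
    using R.finite_field_mult_group_has_gen by (auto simp: R_def)
  hence "UNIV - {0} = {g ^ i | i :: nat. i \<in> UNIV}"
    unfolding pow by (simp add: mult_of_def R_def)
  thus ?thesis by blast
qed

text \<open>If \<open>g ^ d = 1\<close> with 0 < d < N, the first \<open>d\<close> powers would
  exhaust all N nonzero elements.\<close>

lemma generator_power_eq_cong:
  fixes g :: "'a::{field,finite}"
  assumes g: "\<And>x. x \<noteq> 0 \<Longrightarrow> \<exists>i. x = g ^ i" and "g \<noteq> 0" and eq: "g ^ a = g ^ b"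
  shows "[a = b] (mod (CARD('a) - 1))"
proof -
  define N where "N = CARD('a) - 1"
  have N: "N > 0" using card_mono[of UNIV "{0, 1 :: 'a}"] by (simp add: N_def)
  have *: "[a = b] (mod N)" if "a \<le> b" "g ^ a = g ^ b" for a b
  proof -
    define d where "d = (b - a) mod N"
    have "g ^ (b - a) = 1" using that \<open>g \<noteq> 0\<close> by (simp add: power_diff)
    moreover have "g ^ (N * ((b - a) div N)) = 1"
      using power_card_minus_1[OF \<open>g \<noteq> 0\<close>] by (simp add: power_mult N_def)
    ultimately have gd: "g ^ d = 1"
      unfolding d_def by (metis mult_div_mod_eq mult_1 power_add)
    have "d = 0"
    proof (rule ccontr)
      assume "d \<noteq> 0"
      have "x \<in> (\<lambda>i. g ^ i) ` {..<d}" if x: "x \<in> - {0}" for x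
      proof -
        obtain i where i: "x = g ^ i" using g x by auto
        have "g ^ i = g ^ (d * (i div d) + i mod d)" by simp
        also have "\<dots> = g ^ (i mod d)" unfolding power_add power_mult by (simp add: gd)
        finally show ?thesis using \<open>d \<noteq> 0\<close> i by auto
      qed
      hence "card (- {0 :: 'a}) \<le> card ((\<lambda>i. g ^ i) ` {..<d})" by (intro card_mono) auto
      also have "\<dots> \<le> d" using card_image_le[of "{..<d}" "\<lambda>i. g ^ i"] by simp
      finally have "N \<le> d" by (simp add: N_def Compl_eq_Diff_UNIV card_Diff_subset)
      moreover have "d < N" using N by (simp add: d_def)
      ultimately show False by simp
    qed
    hence "N dvd b - a" by (simp add: d_def mod_eq_0_iff_dvd)
    thus ?thesis using that(1) by (metis cong_altdef_nat cong_sym)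
  qed
  show ?thesis
    using *[of a b] *[of b a] eq unfolding N_def by (metis cong_sym nat_le_linear)
qed

text \<open>The nonzero r-th powers have index \<open>r\<close>; the nontrivial characters of the
  quotient are the powers, for 0 < c < r, of a primitive r-th root of unity raised to the discrete
  logarithm.\<close>

lemma complement_powers_expansion:
  assumes r: "r > 1" "r dvd CARD('a::{field,finite}) - 1"
  shows "\<exists>c>0. \<exists>E. (\<forall>x\<in>- {0 :: 'a}. of_bool (x \<notin> range (\<lambda>y. y ^ r)) = of_real c * (1 + E x)) \<and>
           l1_comb {\<chi> \<in> mult_chars. (\<forall>x\<in>- {0} \<inter> range (\<lambda>y. y ^ r). \<chi> x = 1) \<and> (\<exists>x\<in>- {0}. \<chi> x \<noteq> 1)} 1 E"
    (is "\<exists>c>0. \<exists>E. _ \<and> l1_comb ?K 1 E")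
proof -
  obtain g :: 'a where g: "\<And>x. x \<noteq> 0 \<Longrightarrow> \<exists>i. x = g ^ i" using ex_field_generator by blast
  have r0: "r > 0" using r(1) by simp
  have N: "CARD('a) - 1 > 0" using card_mono[of UNIV "{0, 1 :: 'a}"] by simp
  have "g \<noteq> 0"
  proof
    assume "g = 0"
    \<comment> \<open>Powers of 0 are only 0 and 1, which would leave no room for a divisor
      \<open>r > 1\<close> of the number of nonzero elements.\<close>
    hence "- {0 :: 'a} \<subseteq> {1}" using g by (force simp: power_0_left split: if_splits)
    hence "card (- {0 :: 'a}) \<le> card {1 :: 'a}" by (intro card_mono) auto
    hence "CARD('a) - 1 \<le> 1" by (simp add: Compl_eq_Diff_UNIV card_Diff_subset)
    thus False using r N by (metis dvd_imp_le leD le_trans)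
  qed
  \<comment> \<open>Any choice of logarithm will do: \<open>cong\<close> makes it unique modulo
    \<open>r\<close>, and only this residue is used.\<close>
  define l where "l = (\<lambda>x. SOME i. x = g ^ i)"
  have l: "g ^ l x = x" if "x \<noteq> 0" for x
    unfolding l_def using someI_ex[OF g[OF that]] by simp
  have cong: "[a = b] (mod r)" if "g ^ a = g ^ b" for a b
    by (rule cong_dvd_modulus_nat[OF generator_power_eq_cong r(2)]) (use g \<open>g \<noteq> 0\<close> that in auto)
  have power_iff: "x \<in> range (\<lambda>y. y ^ r) \<longleftrightarrow> r dvd l x" if "x \<noteq> 0" for x
  proof
    assume "x \<in> range (\<lambda>y. y ^ r)"
    then obtain y where y: "x = y ^ r" by blast
    with that r0 have "y \<noteq> 0" by auto
    then obtain i where "y = g ^ i" using g by blast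
    hence "g ^ l x = g ^ (i * r)" using l[OF that] y by (simp add: power_mult)
    from cong[OF this] show "r dvd l x" by (simp add: cong_dvd_iff)
  next
    assume "r dvd l x"
    then obtain k where "l x = k * r" by (metis dvdE mult.commute)
    hence "x = (g ^ k) ^ r" using l[OF that] by (simp flip: power_mult)
    thus "x \<in> range (\<lambda>y. y ^ r)" by blast
  qed
  define \<zeta> where "\<zeta> = cis (2 * pi / real r)"
  note \<zeta>1 = root_of_unity_power_eq_1_iff[OF r0, folded \<zeta>_def]
  note \<zeta>cong = root_of_unity_power_cong[OF r0, folded \<zeta>_def]
  define \<chi> where "\<chi> = (\<lambda>c x. if x = 0 then 0 else \<zeta> ^ (c * l x))"
  define w :: complex where "w = - of_real (1 / (real r - 1))"
  define E where "E = (\<lambda>x. \<Sum>c\<in>{1..<r}. w * \<chi> c x)"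
  have "l1_comb ?K (\<Sum>c\<in>{1..<r}. cmod w) E"
    unfolding E_def
  proof (rule l1_comb_sum)
    fix c assume c: "c \<in> {1..<r}"
    have "\<chi> c (x * y) = \<chi> c x * \<chi> c y" for x y
    proof (cases "x = 0 \<or> y = 0")
      case False
      hence "g ^ l (x * y) = g ^ (l x + l y)" by (simp add: l power_add)
      hence "[c * l (x * y) = c * (l x + l y)] (mod r)" by (intro cong_mult cong cong_refl)
      from \<zeta>cong[OF this] show ?thesis using False by (simp add: \<chi>_def power_add distrib_left)
    qed (auto simp: \<chi>_def)
    hence "\<chi> c \<in> mult_chars" by (simp add: mult_chars_def \<chi>_def \<zeta>_def norm_power)
    moreover have "\<chi> c x = 1" if "x \<in> - {0} \<inter> range (\<lambda>y. y ^ r)" for x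
      using that power_iff[of x] by (simp add: \<chi>_def \<zeta>1)
    moreover have "\<chi> c g \<noteq> 1"
    proof -
      have "[c * l g = c * 1] (mod r)" using \<open>g \<noteq> 0\<close> l[of g] by (intro cong_mult cong cong_refl) simp
      from \<zeta>cong[OF this] have "\<chi> c g = \<zeta> ^ c" using \<open>g \<noteq> 0\<close> by (simp add: \<chi>_def)
      thus ?thesis using c \<zeta>1[of c] by (auto dest: dvd_imp_le)
    qed
    ultimately show "\<chi> c \<in> ?K" using \<open>g \<noteq> 0\<close> by blast
  qed simp
  moreover have "(\<Sum>c\<in>{1..<r}. cmod w) = 1"
    using r unfolding w_def norm_minus_cancel norm_of_real by (simp add: of_nat_diff)
  moreover have "of_bool (x \<notin> range (\<lambda>y. y ^ r)) = of_real (1 - 1 / real r) * (1 + E x)" if x: "x \<noteq> 0" for x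
  proof -
    have "1 + (\<Sum>c\<in>{1..<r}. \<chi> c x) = (\<Sum>c<r. (\<zeta> ^ l x) ^ c)"
      using x r0 by (simp add: \<chi>_def lessThan_atLeast0 sum.atLeast_Suc_lessThan mult.commute flip: power_mult)
    also have "\<dots> = of_nat r * of_bool (x \<in> range (\<lambda>y. y ^ r))"
    proof (cases "r dvd l x")
      case True
      thus ?thesis using \<zeta>1[of "l x"] power_iff[OF x] by simp
    next
      case False
      have "(\<zeta> ^ l x) ^ r = 1" using \<zeta>1[of "l x * r"] by (simp add: power_mult)
      thus ?thesis using False \<zeta>1[of "l x"] power_iff[OF x] by (simp add: geometric_sum)
    qed
    finally have *: "(\<Sum>c\<in>{1..<r}. \<chi> c x) = of_nat r * of_bool (x \<in> range (\<lambda>y. y ^ r)) - 1"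
      by (simp add: algebra_simps)
    have "E x = w * (of_nat r * of_bool (x \<in> range (\<lambda>y. y ^ r)) - 1)"
      unfolding E_def sum_distrib_left[symmetric] * ..
    moreover have "of_nat r \<noteq> (1::complex)" "of_nat r \<noteq> (0::complex)"
      using r by (metis less_irrefl_nat of_nat_1_eq_iff) (use r in auto)
    ultimately show ?thesis
      by (cases "x \<in> range (\<lambda>y. y ^ r)") (simp_all add: w_def field_simps)
  qed
  moreover have "1 - 1 / real r > 0" using r by simp
  ultimately show ?thesis by (metis (no_types, lifting) ComplD singletonI)
qed

section \<open>Prime factors on the multiplicative side\<close>

lemma mult_char_power:
  assumes "\<chi> \<in> mult_chars"
  shows "\<chi> (x ^ k) = \<chi> x ^ k"
proof (induction k)
  case 0
  have "\<chi> (1 * 1) = \<chi> 1 * \<chi> 1" "cmod (\<chi> 1) = 1"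
    using assms unfolding mult_chars_def by (blast, simp)
  moreover from this have "\<chi> 1 \<noteq> 0" by auto
  ultimately show ?case by simp
next
  case (Suc k)
  thus ?case using assms by (simp add: mult_chars_def)
qed

lemma mult_chars_mult: "\<chi> \<in> mult_chars \<Longrightarrow> \<chi>' \<in> mult_chars \<Longrightarrow> (\<lambda>x. \<chi> x * \<chi>' x) \<in> mult_chars"
  by (auto simp: mult_chars_def norm_mult)

text \<open>\<open>\<chi> x\<close> is killed by the exponents \<open>r\<close> and
  \<open>\<Prod>I\<close>, which are coprime.\<close>

lemma prime_powers_generate:
  fixes \<chi> :: "'a::field \<Rightarrow> complex"
  assumes \<chi>: "\<chi> \<in> mult_chars" and "prime r" "finite I" "\<And>s. s \<in> I \<Longrightarrow> prime s" "r \<notin> I"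
    and 1: "\<forall>x\<in>- {0} \<inter> range (\<lambda>y. y ^ r). \<chi> x = 1"
    and 2: "\<forall>x\<in>- {0} \<inter> (\<Inter>s\<in>I. range (\<lambda>y. y ^ s)). \<chi> x = 1"
    and "x \<noteq> 0"
  shows "\<chi> x = 1"
proof -
  define M where "M = \<Prod>I"
  have "coprime M r"
    unfolding M_def using assms(2,4,5) by (intro prod_coprime_left primes_coprime) auto
  moreover have "M \<noteq> 0" using assms(3) assms(4)[of 0] by (auto simp: M_def)
  ultimately obtain u v where uv: "M * u = r * v + 1"
    using bezout_nat[of M r] by auto
  have "x ^ r \<in> range (\<lambda>y. y ^ r)" by blast
  hence r1: "\<chi> x ^ r = 1" using 1 \<open>x \<noteq> 0\<close> mult_char_power[OF \<chi>, of x r] by auto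
  have "x ^ M \<in> range (\<lambda>y. y ^ s)" if "s \<in> I" for s
  proof -
    have "M = \<Prod>(I - {s}) * s" unfolding M_def using prod.remove[OF assms(3) that, of "\<lambda>x. x"] by simp
    hence "x ^ M = (x ^ \<Prod>(I - {s})) ^ s" by (metis power_mult)
    thus ?thesis by blast
  qed
  hence "\<chi> x ^ M = 1" using 2 \<open>x \<noteq> 0\<close> mult_char_power[OF \<chi>, of x M] by auto
  hence "1 = \<chi> x ^ (r * v + 1)" unfolding uv[symmetric] by (simp add: power_mult)
  thus ?thesis using r1 by (simp add: power_mult)
qed

lemma prod_primes_dvd:
  fixes m :: nat
  assumes "finite I" "\<And>p. p \<in> I \<Longrightarrow> prime p \<and> p dvd m"
  shows "\<Prod>I dvd m"
  using assms
proof (induction I)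
  case (insert p I)
  have "coprime p (\<Prod>I)"
    using insert by (intro prod_coprime_right primes_coprime) auto
  thus ?case using insert by (simp add: divides_mult)
qed simp

lemma W_nat_ge:
  assumes "m > 0"
  shows "2 ^ card (prime_factors m) \<le> W_nat m"
proof -
  have prime: "prime p" if "I \<subseteq> prime_factors m" "p \<in> I" for I p using that by auto
  have fin: "finite I" if "I \<subseteq> prime_factors m" for I using that by (rule finite_subset) simp
  have pf: "prime_factors (\<Prod>I) = I" if I: "I \<subseteq> prime_factors m" for I
  proof -
    \<comment> \<open>The set is recovered as the prime factors of its product, which gives
      injectivity.\<close>
    have "0 \<notin> I" using prime[OF I] not_prime_0 by blast
    hence "prime_factors (\<Prod>I) = (\<Union>p\<in>I. prime_factors p)"
      using prime_factors_prod[OF fin[OF I], of "\<lambda>x. x"] by simp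
    also have "\<dots> = (\<Union>p\<in>I. {p})"
      using prime[OF I] by (intro SUP_cong) (auto simp: prime_factorization_prime)
    finally show ?thesis by simp
  qed
  have "inj_on (\<lambda>I. \<Prod>I) (Pow (prime_factors m))"
    by (rule inj_on_inverseI[where g = prime_factors]) (auto simp: pf)
  moreover have "(\<lambda>I. \<Prod>I) ` Pow (prime_factors m) \<subseteq> {d. d dvd m \<and> squarefree d}"
  proof safe
    fix I assume I: "I \<subseteq> prime_factors m"
    show "squarefree (\<Prod>I)"
      using prime[OF I] by (intro squarefree_prod_coprime primes_coprime squarefree_prime) auto
    show "\<Prod>I dvd m"
      using prime[OF I] I fin[OF I] by (intro prod_primes_dvd) auto
  qed
  moreover have "finite {d. d dvd m \<and> squarefree d}" using assms by simp
  ultimately have "card (Pow (prime_factors m)) \<le> W_nat m"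
    unfolding W_nat_def by (rule card_inj_on_le)
  thus ?thesis by (simp add: card_Pow)
qed

lemma m_free_if_avoids_prime_powers:
  assumes "\<forall>r\<in>prime_factors m. \<alpha> \<notin> range (\<lambda>y. y ^ r)" "\<alpha> \<noteq> 0" "m > 0"
  shows "m_free m \<alpha>"
  unfolding m_free_def
proof (intro conjI allI impI)
  fix d \<beta> assume d: "d > 0 \<and> d dvd m \<and> \<alpha> = \<beta> ^ d"
  show "d = 1"
  proof (rule ccontr)
    assume "d \<noteq> 1"
    then obtain r where r: "prime r" "r dvd d" using prime_factor_nat by blast
    hence "r \<in> prime_factors m" using d assms(3) by (auto simp: prime_factors_dvd intro: dvd_trans)
    moreover have "\<alpha> = (\<beta> ^ (d div r)) ^ r" using r d by (simp flip: power_mult)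
    ultimately show False using assms(1) by blast
  qed
qed (rule assms(2))

lemma frobenius_power_CHAR:
  assumes "prime CHAR('a::{field,finite})" "e > 0"
  shows "frobenius_power TYPE('a) (CHAR('a) ^ e)"
proof
  show "CHAR('a) ^ e > 1"
    using assms prime_gt_1_nat by (metis one_less_power)
qed (rule freshmans_dream'[OF assms(1) refl])

text \<open>The character is \<open>x \<mapsto> exp (2 \<pi> i Tr x / p)\<close>, with \<open>Tr\<close> the absolute trace.\<close>
lemma ex_additive_character:
  assumes p: "prime CHAR('a::{field,finite})" and card: "CARD('a) = CHAR('a) ^ N"
  shows "\<exists>\<psi> :: 'a \<Rightarrow> complex. additive_character \<psi>"
proof -
  define p where "p = CHAR('a)"
  have p1: "p > 1" using assms(1) prime_gt_1_nat by (simp add: p_def)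
  interpret frobenius_power p "TYPE('a)"
    using frobenius_power_CHAR[OF p, of 1] by (simp add: p_def)
  have N: "N > 0"
    using card card_mono[of UNIV "{0, 1 :: 'a}"] by (cases N) auto
  \<comment> \<open>The p-associate of 1 + x + ... + x^(N-1) is the absolute trace. Its degree stays
    below \<open>N\<close>, so it has too few zeros to vanish everywhere.\<close>
  define h :: "'a poly" where "h = (\<Sum>i<N. monom 1 i)"
  have coeff_h: "coeff h i = of_bool (i < N)" for i
    by (simp add: h_def coeff_sum)
  have deg_h: "degree h \<le> N - 1" by (rule degree_le) (auto simp: coeff_h)
  define Tr :: "'a \<Rightarrow> 'a" where "Tr = Lq p h"
  have Tr: "Tr x = (\<Sum>i<N. x ^ (p ^ i))" for x
  proof -
    have "{..N - 1} = {..<N}" using N by auto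
    thus ?thesis by (simp add: Tr_def Lq_altdef[OF deg_h] coeff_h)
  qed
  have "Tr x ^ p = Tr x" for x
  proof -
    have "Tr x ^ p - Tr x = (\<Sum>i<N. x ^ (p ^ Suc i) - x ^ (p ^ i))"
      unfolding Tr frob_sum by (simp add: sum_subtractf mult.commute flip: power_mult)
    also have "\<dots> = x ^ (p ^ N) - x ^ (p ^ 0)" by (rule sum_lessThan_telescope)
    also have "\<dots> = 0" using power_card_eq_same[of x] card by (simp add: p_def)
    finally show ?thesis by simp
  qed
  \<comment> \<open>The \<open>p\<close> elements of the prime field already fill the zeros of y^p -
    y.\<close>
  moreover have "{y :: 'a. y ^ p = y} = of_nat ` {..<p}"
  proof (rule card_seteq[symmetric])
    have inj: "inj_on (of_nat :: nat \<Rightarrow> 'a) {..<p}"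
      by (rule inj_onI) (auto simp: of_nat_eq_iff_cong_CHAR cong_def p_def)
    define P :: "'a poly" where "P = monom 1 p - monom 1 1"
    have "coeff P p = 1" using p1 by (simp add: P_def)
    hence "P \<noteq> 0" by auto
    moreover have "degree P \<le> p"
      unfolding P_def using p1 by (intro degree_diff_le) (auto simp: degree_monom_eq)
    moreover have "poly P y = y ^ p - y" for y by (simp add: P_def poly_monom)
    ultimately have "card {y :: 'a. y ^ p = y} \<le> p"
      using card_poly_roots_bound[of P] by simp
    thus "card {y :: 'a. y ^ p = y} \<le> card ((of_nat :: nat \<Rightarrow> 'a) ` {..<p})"
      by (simp add: card_image[OF inj])
    have "(of_nat k :: 'a) ^ p = of_nat k" for k
      using p1 by (induction k) (simp_all add: frob power_0_left)
    thus "(of_nat :: nat \<Rightarrow> 'a) ` {..<p} \<subseteq> {y. y ^ p = y}" by auto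
  qed simp
  ultimately have "\<forall>x. \<exists>t. of_nat t = Tr x" by (metis (mono_tags, lifting) imageE mem_Collect_eq)
  \<comment> \<open>Natural representatives of the trace; they are additive only modulo
    \<open>p\<close>, which the p-th root of unity does not notice.\<close>
  then obtain t where t: "\<And>x. of_nat (t x) = Tr x" by metis
  note \<zeta>1 = root_of_unity_power_eq_1_iff[of p] and \<zeta>cong = root_of_unity_power_cong[of p]
  have "additive_character (\<lambda>x. cis (2 * pi / real p) ^ t x)"
  proof
    fix x y
    have "(of_nat (t (x + y)) :: 'a) = of_nat (t x + t y)"
      by (simp add: t Tr_def Lq_add_right)
    hence "[t (x + y) = t x + t y] (mod p)" by (simp only: of_nat_eq_iff_cong_CHAR p_def)
    thus "cis (2 * pi / real p) ^ t (x + y) = cis (2 * pi / real p) ^ t x * cis (2 * pi / real p) ^ t y"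
      using \<zeta>cong p1 by (simp flip: power_add)
  next
    have "h \<noteq> 0" using coeff_h[of 0] N by auto
    moreover have "p ^ degree h < CARD('a)"
      unfolding card p_def[symmetric] using deg_h N p1 by (intro power_strict_increasing) auto
    ultimately obtain x :: 'a where "Tr x \<noteq> 0" using Lq_nonzero_value unfolding Tr_def by blast
    hence "\<not> p dvd t x" by (metis of_nat_eq_0_iff_char_dvd p_def t)
    thus "\<exists>x. cis (2 * pi / real p) ^ t x \<noteq> 1" using \<zeta>1 p1 by auto
  qed (simp add: norm_power)
  thus ?thesis by blast
qed

section \<open>Positivity of \<open>N_f\<close>\<close>

theorem theorem4p2:
  fixes q n k m :: nat and f T :: "'a::{field,finite} poly"
  assumes "\<exists>p e. prime p \<and> e > 0 \<and> q = p ^ e"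
    and "n > 0"
    and "card (UNIV :: 'a set) = q ^ n"
    and "f \<in> monic_Fq_divisors q (monom 1 n - 1)"
    and "T \<in> monic_Fq_divisors q (monom 1 n - 1)"
    and "degree f = k"
    and "Fq_gcd_ne_1 q ((monom 1 n - 1) div f) T"
    and "m > 0" and "m dvd q ^ n - 1"
    and "real q powr (real n / 2 - real k) \<ge> real (W_nat m * W_poly q T)"
  shows "N_f q f T m > 0"
proof -
  obtain p e where p: "prime p" and e: "e > 0" and q: "q = p ^ e" using assms(1) by blast
  \<comment> \<open>The prime behind \<open>q\<close> must be the characteristic before q-th powers
    are known to be additive.\<close>
  have "CHAR('a) dvd p ^ (e * n)"
    using CHAR_dvd_CARD[where 'a = 'a] assms(3) by (simp add: q power_mult)
  moreover have prime_CHAR: "prime CHAR('a)"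
    by (rule prime_CHAR_semidom) (simp add: finite_imp_CHAR_pos)
  ultimately have CHAR: "CHAR('a) = p"
    using p by (metis prime_dvd_power primes_dvd_imp_eq)
  interpret frobenius_power q "TYPE('a)"
    using frobenius_power_CHAR[OF prime_CHAR e] by (simp add: CHAR q)
  obtain \<psi> :: "'a \<Rightarrow> complex" where "additive_character \<psi>"
    using ex_additive_character[OF prime_CHAR, of "e * n"] assms(3) by (auto simp: CHAR q power_mult)
  then interpret \<psi>: additive_character \<psi> .

  have f: "f \<noteq> 0" and T: "T \<noteq> 0" "Fq_poly q T" "T dvd monom 1 n - 1"
    using assms(4,5) by (auto simp: monic_Fq_divisors_iff)
  have ker: "card {x. Lq q f x = 0} \<le> q ^ k"
    using card_kernel_Lq[OF f] assms(6) by simp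

  define S where "S = Fq_prime_divisors T"
  have S: "Fq_prime P" "P dvd monom 1 n - 1" if "P \<in> S" for P
    using that T(3) by (auto simp: S_def Fq_prime_divisors_def intro: dvd_trans)
  have "\<exists>c>0. \<exists>E. (\<forall>x\<in>UNIV. of_bool (\<forall>P\<in>S. x \<notin> range (Lq q P)) = of_real c * (1 + E x)) \<and>
      l1_comb {\<chi> \<in> \<psi>.chars. (\<forall>x\<in>UNIV \<inter> (\<Inter>P\<in>S. range (Lq q P)). \<chi> x = 1) \<and> (\<exists>x\<in>UNIV. \<chi> x \<noteq> 1)}
        (2 ^ card S - 1) E"
  proof (rule sieve_expansion)
    show "finite S" unfolding S_def by (rule finite_Fq_prime_divisors[OF T(1)])
  next
    fix P assume "P \<in> S"
    hence "range (Lq q P) \<noteq> (UNIV :: 'a set)"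
      using S[of P] assms(2,3) by (intro range_Lq_proper) (auto simp: Fq_prime_def)
    thus "\<exists>c>0. \<exists>E. (\<forall>x\<in>UNIV. of_bool (x \<notin> range (Lq q P)) = of_real c * (1 + E x)) \<and>
        l1_comb {\<chi> \<in> \<psi>.chars. (\<forall>x\<in>UNIV \<inter> range (Lq q P). \<chi> x = 1) \<and> (\<exists>x\<in>UNIV. \<chi> x \<noteq> 1)} 1 E"
      by (intro \<psi>.complement_subgroup_expansion add_subgroup_range Lq_add_right)
  next
    fix P I \<chi>
    assume P: "P \<in> S" and I: "I \<subseteq> S" "P \<notin> I" and \<chi>: "\<chi> \<in> \<psi>.chars"
      and 1: "\<forall>x\<in>UNIV \<inter> range (Lq q P). \<chi> x = 1" "\<forall>x\<in>UNIV \<inter> (\<Inter>Q\<in>I. range (Lq q Q)). \<chi> x = 1"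
    show "\<forall>x\<in>UNIV. \<chi> x = 1"
    proof
      fix x
      obtain y z where yz: "x = y + z" "y \<in> range (Lq q P)" "z \<in> (\<Inter>Q\<in>I. range (Lq q Q))"
        using prime_images_generate[OF P[unfolded S_def] I(1)[unfolded S_def] I(2) T(1)] by blast
      have "\<chi> (y + z) = \<chi> y * \<chi> z"
        using \<chi> by (auto simp: \<psi>.chars_def distrib_left \<psi>.add)
      moreover have "\<chi> y = 1" using 1(1) yz(2) by blast
      moreover have "\<chi> z = 1" using 1(2) yz(3) by blast
      ultimately show "\<chi> x = 1" using yz(1) by simp
    qed
  qed (rule \<psi>.chars_mult)
  then obtain c E where c: "c > 0"
    and E: "\<And>x. of_bool (\<forall>P\<in>S. x \<notin> range (Lq q P)) = of_real c * (1 + E x)"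
    and combE: "l1_comb {\<chi> \<in> \<psi>.chars. (\<forall>x\<in>UNIV \<inter> (\<Inter>P\<in>S. range (Lq q P)). \<chi> x = 1) \<and> (\<exists>x\<in>UNIV. \<chi> x \<noteq> 1)}
        (2 ^ card S - 1) E"
    by blast
  have combE: "l1_comb {\<chi> \<in> \<psi>.chars. \<exists>x. \<chi> x \<noteq> 1} (2 ^ card S - 1) E"
    by (rule l1_comb_mono[OF combE]) auto

  define R where "R = prime_factors m"
  have R: "prime r" "r dvd CARD('a) - 1" if "r \<in> R" for r
    using that assms(3,9) by (auto simp: R_def intro: dvd_trans)
  have "\<exists>d>0. \<exists>G. (\<forall>x\<in>- {0 :: 'a}. of_bool (\<forall>r\<in>R. x \<notin> range (\<lambda>y. y ^ r)) = of_real d * (1 + G x)) \<and>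
      l1_comb {\<chi> \<in> mult_chars. (\<forall>x\<in>- {0} \<inter> (\<Inter>r\<in>R. range (\<lambda>y. y ^ r)). \<chi> x = 1) \<and> (\<exists>x\<in>- {0}. \<chi> x \<noteq> 1)}
        (2 ^ card R - 1) G"
  proof (rule sieve_expansion)
    show "finite R" by (simp add: R_def)
  next
    fix r assume "r \<in> R"
    thus "\<exists>d>0. \<exists>G. (\<forall>x\<in>- {0 :: 'a}. of_bool (x \<notin> range (\<lambda>y. y ^ r)) = of_real d * (1 + G x)) \<and>
        l1_comb {\<chi> \<in> mult_chars. (\<forall>x\<in>- {0} \<inter> range (\<lambda>y. y ^ r). \<chi> x = 1) \<and> (\<exists>x\<in>- {0}. \<chi> x \<noteq> 1)} 1 G"
      using R[of r] prime_gt_1_nat by (intro complement_powers_expansion) auto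
  next
    fix r I and \<chi> :: "'a \<Rightarrow> complex"
    assume "r \<in> R" "I \<subseteq> R" "r \<notin> I" "\<chi> \<in> mult_chars"
      and 1: "\<forall>x\<in>- {0} \<inter> range (\<lambda>y. y ^ r). \<chi> x = 1" "\<forall>x\<in>- {0} \<inter> (\<Inter>s\<in>I. range (\<lambda>y. y ^ s)). \<chi> x = 1"
    moreover have "finite I" using \<open>I \<subseteq> R\<close> by (rule finite_subset) (simp add: R_def)
    ultimately have "\<chi> x = 1" if "x \<noteq> 0" for x
      using R(1) that by (intro prime_powers_generate[of \<chi> r I x]) auto
    thus "\<forall>x\<in>- {0}. \<chi> x = 1" by blast
  qed (rule mult_chars_mult)
  then obtain d and G :: "'a \<Rightarrow> complex" where d: "d > 0"
    and G: "\<And>x. x \<noteq> 0 \<Longrightarrow> of_bool (\<forall>r\<in>R. x \<notin> range (\<lambda>y. y ^ r)) = of_real d * (1 + G x)"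
    and combG: "l1_comb {\<chi> \<in> mult_chars. (\<forall>x\<in>- {0} \<inter> (\<Inter>r\<in>R. range (\<lambda>y. y ^ r)). \<chi> x = 1) \<and> (\<exists>x\<in>- {0}. \<chi> x \<noteq> 1)}
        (2 ^ card R - 1) G"
    by blast
  have combG: "l1_comb {\<chi> \<in> mult_chars. \<exists>x\<in>- {0}. \<chi> x \<noteq> 1} (2 ^ card R - 1) G"
    by (rule l1_comb_mono[OF combG]) auto

  \<comment> \<open>Multiplying q^(n/2 - k) by the kernel bound q^k and the Gauss bound q^(n/2)
    gives exactly q^n.\<close>
  have large: "2 ^ card S * 2 ^ card R * (real (q ^ k) * sqrt CARD('a)) \<le> CARD('a)"
  proof -
    have q0: "real q > 0" using q_gt_1 by simp
    have "2 ^ card S * 2 ^ card R \<le> W_poly q T * W_nat m"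
      using W_poly_ge[OF T(2,1)] W_nat_ge[OF assms(8)] unfolding S_def R_def by (rule mult_mono) auto
    hence "real (2 ^ card S * 2 ^ card R) \<le> real (W_nat m * W_poly q T)"
      unfolding of_nat_le_iff by (simp add: mult.commute)
    also have "\<dots> \<le> real q powr (real n / 2 - real k)" by (rule assms(10))
    finally have "2 ^ card S * 2 ^ card R \<le> real q powr (real n / 2 - real k)" by simp
    moreover have sqrt: "sqrt CARD('a) = real q powr (real n / 2)"
      using q0 by (simp add: assms(3) powr_half_sqrt[symmetric] powr_powr flip: powr_realpow)
    moreover have "real (q ^ k) = real q powr real k" using q0 by (simp add: powr_realpow)
    ultimately have "2 ^ card S * 2 ^ card R * (real (q ^ k) * sqrt CARD('a))
        \<le> real q powr (real n / 2 - real k) * (real q powr real k * real q powr (real n / 2))"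
      by (intro mult_mono) auto
    also have "\<dots> = real q powr real n" by (simp flip: powr_add)
    also have "\<dots> = CARD('a)" using q0 by (simp add: assms(3) powr_realpow)
    finally show ?thesis .
  qed
  obtain a where a: "\<forall>P\<in>S. a \<notin> range (Lq q P)" "Lq q f a \<noteq> 0" "\<forall>r\<in>R. Lq q f a \<notin> range (\<lambda>y. y ^ r)"
    using \<psi>.sieved_element_exists[OF Lq_add_right ker E combE G combG] c d large by auto
  have "M_free q T a" using M_free_if_avoids_prime_images a(1) by (simp add: S_def)
  moreover have "m_free m (Lq q f a)"
    using a(2,3) assms(8) by (intro m_free_if_avoids_prime_powers) (auto simp: R_def)
  ultimately have "a \<in> {\<alpha>. M_free q T \<alpha> \<and> m_free m (Lq q f \<alpha>)}" by simp
  thus ?thesis unfolding N_f_def by (auto simp: card_gt_0_iff)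
qed

end
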